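(* Let $V$ be an arbitrary vector space over a field $k$, and let $f, g \in \operatorname{End}_k(V)$ be two endomorphisms each admitting an annihilating polynomial. Then there exists $\tau \in \operatorname{Aut}_k(V)$ with $g = \tau f \tau^{-1}$ if and only if both of the following hold: (1) $a_g(x) = a_f(x) = p_1(x)^{n_1}\cdots p_r(x)^{n_r}$, where the $p_j(x)$ are pairwise distinct monic irreducible polynomials in $k[x]$ and $n_j \geq 1$; (2) $\nu_i(V,p_j(f)) = \nu_i(V,p_j(g))$ (equality of cardinals) for all $1\leq j\leq r$ and $1\leq i\leq n_j$.
   Context: $V$ is not assumed finite-dimensional. An endomorphism $f\in\operatorname{End}_k(V)$ admits an annihilating polynomial if $p(f)=0$ for some nonzero $p(x)\in k[x]$. In that case the annihilator polynomial $a_f(x)$ is the unique monic generator of the kernel of the ring morphism $k[x]\to \operatorname{End}_k(V)$, $q(x)\mapsto q(f)$. For an irreducible polynomial $p(x)\in k[x]$, put $K=k[x]/(p(x))$. For $i\ge 1$ define the cardinal $$\nu_i(V,p(f)) = \dim_K\Big(\operatorname{Ker} p(f)^i \big/ \big[\operatorname{Ker} p(f)^{i-1} + p(f)\operatorname{Ker} p(f)^{i+1}\big]\Big),$$ where $p(f)^0=\mathrm{id}$ (so $\operatorname{Ker} p(f)^0=0$) and the quotient is a $K$-vector space with $x$ acting by $f$ (it is annihilated by $p(f)$). *)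

theory Defs
  imports "Jordan_Normal_Form.VS_Connect" "HOL-Algebra.QuotRing"
begin

text \<open>
  A \<open>k\<close>-vector space is given by its scalar multiplication \<open>scale\<close>; \<open>poly_end scale f q\<close> is the
  endomorphism \<open>q(f)\<close>.
\<close>

definition poly_end ::
    "('k::field \<Rightarrow> 'v::ab_group_add \<Rightarrow> 'v) \<Rightarrow> ('v \<Rightarrow> 'v) \<Rightarrow> 'k poly \<Rightarrow> 'v \<Rightarrow> 'v" where
  "poly_end scale f q v = (\<Sum>i\<le>degree q. scale (coeff q i) ((f ^^ i) v))"

definition admits_annihilating_poly ::
    "('k::field \<Rightarrow> 'v::ab_group_add \<Rightarrow> 'v) \<Rightarrow> ('v \<Rightarrow> 'v) \<Rightarrow> bool" where
  "admits_annihilating_poly scale f \<longleftrightarrow> (\<exists>q. q \<noteq> 0 \<and> poly_end scale f q = (\<lambda>_. 0))"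

text \<open>\<open>PIdl\<^bsub>class_ring\<^esub> a\<close> is the ideal of \<open>k[x]\<close> generated by \<open>a\<close>.\<close>

definition annihilator_poly ::
    "('k::field \<Rightarrow> 'v::ab_group_add \<Rightarrow> 'v) \<Rightarrow> ('v \<Rightarrow> 'v) \<Rightarrow> 'k poly" where
  "annihilator_poly scale f =
     (THE a. lead_coeff a = 1 \<and> PIdl\<^bsub>class_ring\<^esub> a = {q. poly_end scale f q = (\<lambda>_. 0)})"

definition poly_residue_field :: "'k::field poly \<Rightarrow> 'k poly set ring" where
  "poly_residue_field p = class_ring Quot (PIdl\<^bsub>class_ring\<^esub> p)"

definition ker_pow ::
    "('k::field \<Rightarrow> 'v::ab_group_add \<Rightarrow> 'v) \<Rightarrow> ('v \<Rightarrow> 'v) \<Rightarrow> 'k poly \<Rightarrow> nat \<Rightarrow> 'v set" where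
  "ker_pow scale f p i = {v. (poly_end scale f p ^^ i) v = 0}"

text \<open>Meant for \<open>i \<ge> 1\<close> only (\<open>i - 1\<close> is truncated).\<close>

definition nu_denominator ::
    "('k::field \<Rightarrow> 'v::ab_group_add \<Rightarrow> 'v) \<Rightarrow> ('v \<Rightarrow> 'v) \<Rightarrow> 'k poly \<Rightarrow> nat \<Rightarrow> 'v set" where
  "nu_denominator scale f p i =
     {u + poly_end scale f p w | u w. u \<in> ker_pow scale f p (i - 1) \<and> w \<in> ker_pow scale f p (i + 1)}"

text \<open>
  The quotient as a \<open>k[x]/(p)\<close>-module: a class of polynomials \<open>C\<close> maps the coset \<open>X\<close> to the
  coset of \<open>q(f) v\<close>, for any \<open>q \<in> C\<close> and \<open>v \<in> X\<close> (the union is over equal cosets).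
  Modules of the library are rings with an extra operation, whose multiplication is irrelevant.
\<close>

definition nu_quotient ::
    "('k::field \<Rightarrow> 'v::ab_group_add \<Rightarrow> 'v) \<Rightarrow> ('v \<Rightarrow> 'v) \<Rightarrow> 'k poly \<Rightarrow> nat \<Rightarrow> ('k poly set, 'v set) module" where
  "nu_quotient scale f p i =
     (let N = \<lparr>carrier = ker_pow scale f p i, mult = undefined, one = undefined, zero = 0, add = (+)\<rparr>;
          D = nu_denominator scale f p i
      in \<lparr>carrier = a_rcosets\<^bsub>N\<^esub> D, mult = undefined, one = undefined, zero = D, add = set_add N,
          smult = (\<lambda>C X. \<Union>q\<in>C. \<Union>v\<in>X. D +>\<^bsub>N\<^esub> poly_end scale f q v)\<rparr>)"

text \<open>
  The dimension as a cardinal: the cardinality of a basis, which depends on the choice of the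
  basis only up to \<^const>\<open>ordIso\<close>. The library's own dimension is a natural number.
\<close>

definition vs_dim :: "('k, 'c) ring_scheme \<Rightarrow> ('k, 'v, 'd) module_scheme \<Rightarrow> 'v rel" where
  "vs_dim K M = card_of (SOME B. vectorspace.basis K M B)"

definition nu ::
    "('k::field \<Rightarrow> 'v::ab_group_add \<Rightarrow> 'v) \<Rightarrow> ('v \<Rightarrow> 'v) \<Rightarrow> 'k poly \<Rightarrow> nat \<Rightarrow> 'v set rel" where
  "nu scale f p i = vs_dim (poly_residue_field p) (nu_quotient scale f p i)"

end

theory Submission
  imports Defs
begin

text \<open>
  Regard \<open>V\<close> as a \<open>k[x]\<close>-module with \<open>x\<close> acting by \<open>f\<close>; conjugate endomorphisms are those with isomorphic
  modules. Lift a basis of every quotient \<open>ker p^i / (ker p^(i-1) + p ker p^(i+1))\<close> to elements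
  of \<open>V\<close>. Each lifted element generates a cyclic submodule isomorphic to \<open>k[x]/(p^i)\<close>, and \<open>V\<close> is the direct
  sum of these cyclic submodules. The annihilator polynomial tells which pairs \<open>(p, i)\<close> can occur and
  \<open>\<nu>\<^sub>i\<close> is the number of summands for such a pair, so these data determine the module up to
  isomorphism. That the dimension of the quotient is well defined needs the invariance of the cardinality
  of bases for infinite dimensions too.
\<close>

text \<open>A summand \<open>k[x]/(p^m)\<close> of V shows in the quotient at \<open>i\<close> as
  one copy of \<open>K\<close> if \<open>m = i\<close>, and not at all otherwise: what a shorter
  summand contributes lies in \<open>ker p^(i-1)\<close>, and what a longer one contributes to
  \<open>ker p^i\<close> is \<open>p\<close> times something in \<open>ker p^(i+1)\<close>. This is
  where the denominator comes from. As V may have infinite dimension, there is no induction on the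
  dimension and all generators are chosen at once. The annihilating polynomial replaces finiteness:
  it bounds the exponents and so gives the descending induction its starting point. Two notions of
  module meet: the quotient is a record over the residue field, while V is a type with a
  \<open>k[x]\<close>-action. A set of representatives with polynomial coefficients expresses a
  basis of the quotient in terms of V alone, so that the structure theory never handles
  cosets.\<close>

subsection \<open>Bases of arbitrary vector spaces\<close>

context vectorspace
begin

context includes cardinal_syntax
begin

text \<open>Zorn's lemma applies because a dependence relation involves finitely many vectors, which
  all lie in one member of a chain.\<close>

lemma basis_exists: "\<exists>B. basis B"
proof -
  define I where "I = {S. S \<subseteq> carrier V \<and> lin_indpt S}"
  have "\<exists>M\<in>I. \<forall>X\<in>I. M \<subseteq> X \<longrightarrow> X = M"
  proof (rule subset_Zorn_nonempty)
    have "lin_indpt {}" unfolding lin_dep_def by auto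
    then show "I \<noteq> {}" unfolding I_def by auto
  next
    fix C assume C: "C \<noteq> {}" "subset.chain I C"
    have sub: "\<Union>C \<subseteq> carrier V" using C(2) by (auto simp: I_def subset.chain_def)
    have "lin_indpt (\<Union>C)"
    proof
      assume "lin_dep (\<Union>C)"
      then obtain A a v where A: "finite A" "A \<subseteq> \<Union>C" "a \<in> A \<rightarrow> carrier K"
          "lincomb a A = \<zero>\<^bsub>V\<^esub>" "v \<in> A" "a v \<noteq> \<zero>\<^bsub>K\<^esub>"
        unfolding lin_dep_def by blast
      obtain S where S: "S \<in> C" "A \<subseteq> S"
        using finite_subset_Union_chain[OF A(1,2) C] by blast
      then have "lin_dep S" unfolding lin_dep_def using A by blast
      then show False using S(1) C(2) by (auto simp: I_def subset.chain_def)
    qed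
    then show "\<Union>C \<in> I" using sub by (simp add: I_def)
  qed
  then obtain M where M: "M \<in> I" "\<And>X. X \<in> I \<Longrightarrow> M \<subseteq> X \<Longrightarrow> X = M" by blast
  then have "maximal M (\<lambda>S. S \<subseteq> carrier V \<and> lin_indpt S)"
    unfolding maximal_def I_def by blast
  then show ?thesis using max_li_is_basis by blast
qed

text \<open>Finite bases are compared by the exchange lemma. If \<open>B\<close> is infinite, each
  of its elements needs only finitely many elements of \<open>B'\<close>. Together these span, so by
  independence they exhaust \<open>B'\<close>, and a union of finite sets indexed by the infinite
  set \<open>B\<close> is no larger than \<open>B\<close>.\<close>

lemma basis_ordLeq:
  assumes B: "basis B" and B': "basis B'"
  shows "|B'| \<le>o |B|"
proof (cases "finite B")
  case True
  then have "fin_dim" using B unfolding fin_dim_def basis_def by blast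
  then have fin: "finite B'" using B' fin_dim_li_fin unfolding basis_def by blast
  have "card B' \<le> card B"
    using li_smaller_than_gen[OF fin True] B B' unfolding basis_def by blast
  then show ?thesis using inj_on_iff_card_le[OF fin True] by (simp add: card_of_ordLeq[symmetric])
next
  case False
  have "\<exists>A. finite A \<and> A \<subseteq> B' \<and> b \<in> span A" if "b \<in> B" for b
  proof -
    have "b \<in> span B'" using that B B' unfolding basis_def by blast
    then obtain A a where A: "finite A" "A \<subseteq> B'" "a \<in> A \<rightarrow> carrier K" "b = lincomb a A"
      unfolding span_def by blast
    then have "b \<in> span A" unfolding span_def by blast
    then show ?thesis using A by blast
  qed
  then obtain F where F: "\<And>b. b \<in> B \<Longrightarrow> finite (F b) \<and> F b \<subseteq> B' \<and> b \<in> span (F b)"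
    by metis
  define T where "T = (\<Union>b\<in>B. F b)"
  have TB: "T \<subseteq> B'" unfolding T_def using F by blast
  have B'V: "B' \<subseteq> carrier V" using B' unfolding basis_def by blast
  have "B \<subseteq> span T"
  proof
    fix b assume "b \<in> B"
    then have "b \<in> span (F b)" "F b \<subseteq> T" using F unfolding T_def by auto
    then show "b \<in> span T" using span_is_monotone by blast
  qed
  then have "span B \<subseteq> span T"
    using span_is_subset span_is_submodule TB B'V by (metis order_trans)
  then have gen: "carrier V \<subseteq> span T" using B unfolding basis_def by blast
  have "B' \<subseteq> T"
  proof
    fix v assume v: "v \<in> B'"
    show "v \<in> T"
    proof (rule ccontr)
      assume nv: "v \<notin> T"
      have li: "lin_indpt T" using B' TB subset_li_is_li unfolding basis_def by blast
      have "v \<in> carrier V" using v B'V by blast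
      then have "lin_dep (T \<union> {v})"
        using lin_dep_iff_in_span[of T v] TB B'V li nv gen by blast
      moreover have "T \<union> {v} \<subseteq> B'" using TB v by blast
      ultimately show False using B' supset_ld_is_ld unfolding basis_def by blast
    qed
  qed
  then have "|B'| \<le>o |T|" by (rule card_of_mono1)
  also have "|T| \<le>o |B|" unfolding T_def
  proof (rule card_of_UNION_ordLeq_infinite[OF False])
    show "\<forall>b\<in>B. |F b| \<le>o |B|"
      using F False by (meson card_of_Well_order card_of_ordLeq_infinite ordLeq_total)
  qed (rule card_of_mono1, simp)
  finally show ?thesis .
qed

text \<open>The basis chosen in \<open>vs_dim\<close> stands for any other, by
  \<open>basis_ordLeq\<close> in both directions.\<close>

lemma vs_dim_ordIso:
  assumes "basis B" shows "|B| =o vs_dim K V"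
proof -
  have "basis (SOME B. basis B)" using basis_exists by (rule someI_ex)
  then show ?thesis
    unfolding vs_dim_def using basis_ordLeq assms by (simp add: ordIso_iff_ordLeq)
qed

end

end

subsection \<open>Representatives of bases of quotients\<close>

text \<open>
  The set \<open>R\<close> represents a basis of \<open>N/D\<close> over the residue field of \<open>p\<close>; the sums carry coefficients
  in the ring itself.
\<close>

definition rep_basis ::
    "('r::comm_ring_1 \<Rightarrow> 'v::ab_group_add \<Rightarrow> 'v) \<Rightarrow> 'v set \<Rightarrow> 'v set \<Rightarrow> 'r \<Rightarrow> 'v set \<Rightarrow> bool" where
  "rep_basis act N D p R \<longleftrightarrow> R \<subseteq> N \<and>
     (\<forall>v\<in>N. \<exists>S q. finite S \<and> S \<subseteq> R \<and> v - (\<Sum>b\<in>S. act (q b) b) \<in> D) \<and>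
     (\<forall>S q. finite S \<longrightarrow> S \<subseteq> R \<longrightarrow> (\<Sum>b\<in>S. act (q b) b) \<in> D \<longrightarrow> (\<forall>b\<in>S. p dvd q b))"

lemma rep_basis_subset: "rep_basis act N D p R \<Longrightarrow> R \<subseteq> N"
  by (simp add: rep_basis_def)

lemma rep_basisD:
  "rep_basis act N D p R \<Longrightarrow> finite S \<Longrightarrow> S \<subseteq> R \<Longrightarrow> (\<Sum>b\<in>S. act (q b) b) \<in> D \<Longrightarrow> b \<in> S \<Longrightarrow> p dvd q b"
  unfolding rep_basis_def by blast

text \<open>
  A vector space \<open>V\<close> over \<open>K = R/(p)\<close> that is, through the classes \<open>cl\<close> and \<open>cs\<close>, the quotient of
  the \<open>R\<close>-module \<open>N\<close> by \<open>D\<close>.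
\<close>

locale residue_presentation = vectorspace K V + act: Modules.module act
  for K :: "('a, 'b) ring_scheme" (structure) and V :: "('a, 'c, 'd) module_scheme" (structure)
    and act :: "'r::comm_ring_1 \<Rightarrow> 'v::ab_group_add \<Rightarrow> 'v" +
  fixes N D :: "'v set" and p :: 'r and cl :: "'r \<Rightarrow> 'a" and cs :: "'v \<Rightarrow> 'c"
  assumes N: "act.subspace N"
    and carrier_K: "carrier K = range cl"
    and carrier_V: "carrier V = cs ` N"
    and cl_eq_zero: "cl q = \<zero>\<^bsub>K\<^esub> \<longleftrightarrow> p dvd q"
    and cs_eq: "v \<in> N \<Longrightarrow> w \<in> N \<Longrightarrow> cs v = cs w \<longleftrightarrow> v - w \<in> D"
    and cs_add: "v \<in> N \<Longrightarrow> w \<in> N \<Longrightarrow> cs v \<oplus>\<^bsub>V\<^esub> cs w = cs (v + w)"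
    and cs_zero: "cs 0 = \<zero>\<^bsub>V\<^esub>"
    and cs_act: "v \<in> N \<Longrightarrow> cl q \<odot>\<^bsub>V\<^esub> cs v = cs (act q v)"
begin

lemma cs_eq_zero: "v \<in> N \<Longrightarrow> cs v = \<zero>\<^bsub>V\<^esub> \<longleftrightarrow> v \<in> D"
  using cs_eq[of v 0] act.subspace_0[OF N] cs_zero by simp

lemma sum_in_N: "S \<subseteq> N \<Longrightarrow> (\<Sum>b\<in>S. act (q b) b) \<in> N"
  using N by (intro act.subspace_sum act.subspace_scale) auto

text \<open>Linear combinations are indexed by sets of vectors, so distinct representatives must
  give distinct cosets; otherwise terms of the sum would be merged.\<close>

lemma lincomb_cs:
  assumes "finite S" "S \<subseteq> N" "inj_on cs S" "\<And>v. v \<in> S \<Longrightarrow> a (cs v) = cl (q v)"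
  shows "lincomb a (cs ` S) = cs (\<Sum>v\<in>S. act (q v) v)"
  using assms
proof (induction S)
  case empty
  then show ?case by (simp add: lincomb_def cs_zero)
next
  case (insert v S)
  have v: "v \<in> N" "S \<subseteq> N" using insert by auto
  have notin: "cs v \<notin> cs ` S" using insert by (auto simp: inj_on_def)
  have "lincomb a (cs ` S \<union> {cs v}) = a (cs v) \<odot>\<^bsub>V\<^esub> cs v \<oplus>\<^bsub>V\<^esub> lincomb a (cs ` S)"
  proof (rule lincomb_insert)
    show "a \<in> cs ` S \<union> {cs v} \<rightarrow> carrier K" using insert.prems(3) by (auto simp: carrier_K)
  qed (use insert v notin in \<open>auto simp: carrier_V\<close>)
  also have "\<dots> = cs (act (q v) v) \<oplus>\<^bsub>V\<^esub> cs (\<Sum>v\<in>S. act (q v) v)"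
    using insert v by (simp add: cs_act)
  also have "\<dots> = cs (act (q v) v + (\<Sum>v\<in>S. act (q v) v))"
    using v act.subspace_scale[OF N] by (intro cs_add sum_in_N) auto
  finally show ?case using insert by simp
qed

lemma subset_cs_imageE:
  assumes "finite A" "A \<subseteq> cs ` R"
  obtains S where "finite S" "S \<subseteq> R" "A = cs ` S" "inj_on cs S"
  using assms by (metis subset_image_inj finite_imageD)

text \<open>If two representatives had the same coset, their combination with coefficients 1 and -1
  would lie in \<open>D\<close>. Then \<open>p\<close> would divide 1 and the residue field would be
  zero.\<close>

lemma rep_basis_imp_inj_on:
  assumes "rep_basis act N D p R"
  shows "inj_on cs R"
proof (rule inj_onI, rule ccontr)
  fix v w assume vw: "v \<in> R" "w \<in> R" "cs v = cs w" "v \<noteq> w"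
  have "v \<in> N" "w \<in> N" using vw(1,2) assms by (auto simp: rep_basis_def)
  then have "v - w \<in> D" using cs_eq vw(3) by simp
  then have "(\<Sum>b\<in>{v, w}. act (if b = v then 1 else - 1) b) \<in> D" using vw by simp
  then have "p dvd (if v = v then 1 else - 1)"
    using rep_basisD[OF assms, of "{v, w}" "\<lambda>b. if b = v then 1 else - 1" v] vw by simp
  then have "p dvd 1" by simp
  then have "p dvd q" for q by (metis dvd_trans one_dvd)
  then have "carrier K = {\<zero>\<^bsub>K\<^esub>}" unfolding carrier_K using cl_eq_zero by auto
  then show False using one_not_zero one_closed by auto
qed

text \<open>Coefficients in \<open>K\<close> are classes of ring elements, and a class is zero
  exactly when \<open>p\<close> divides the element. Spanning and independence therefore translate
  separately.\<close>

lemma rep_basis_iff_basis: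
  assumes "R \<subseteq> N" "inj_on cs R"
  shows "rep_basis act N D p R \<longleftrightarrow> basis (cs ` R)"
proof
  assume R: "rep_basis act N D p R"
  have "lin_indpt (cs ` R)"
  proof
    assume "lin_dep (cs ` R)"
    then obtain A a x where A: "finite A" "A \<subseteq> cs ` R" "a \<in> A \<rightarrow> carrier K"
      "lincomb a A = \<zero>\<^bsub>V\<^esub>" "x \<in> A" "a x \<noteq> \<zero>\<^bsub>K\<^esub>" unfolding lin_dep_def by blast
    obtain S where S: "finite S" "S \<subseteq> R" "A = cs ` S" "inj_on cs S"
      using subset_cs_imageE[OF A(1,2)] .
    have "\<forall>v\<in>S. \<exists>r. a (cs v) = cl r" using A(3) S(3) by (auto simp: carrier_K Pi_def)
    then obtain q where q: "\<And>v. v \<in> S \<Longrightarrow> a (cs v) = cl (q v)" by metis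
    have SN: "S \<subseteq> N" using S assms by auto
    have "cs (\<Sum>v\<in>S. act (q v) v) = \<zero>\<^bsub>V\<^esub>"
      using lincomb_cs[where a = a and q = q, OF S(1) SN S(4) q] A(4) S(3) by simp
    then have "(\<Sum>v\<in>S. act (q v) v) \<in> D" using cs_eq_zero sum_in_N[OF SN] by blast
    then have "\<forall>v\<in>S. p dvd q v" using R S unfolding rep_basis_def by blast
    then show False using A(5,6) S(3) q cl_eq_zero by auto
  qed
  moreover have "carrier V \<subseteq> span (cs ` R)"
  proof
    fix x assume "x \<in> carrier V"
    then obtain v where v: "v \<in> N" "x = cs v" by (auto simp: carrier_V)
    then obtain S q where S: "finite S" "S \<subseteq> R" "v - (\<Sum>b\<in>S. act (q b) b) \<in> D"
      using R unfolding rep_basis_def by blast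
    have SN: "S \<subseteq> N" and inj: "inj_on cs S" using S assms inj_on_subset by auto
    \<comment> \<open>A coefficient belongs to a coset here, so it is read off at the unique
      representative in \<open>S\<close>.\<close>
    define a where "a = (\<lambda>y. cl (q (the_inv_into S cs y)))"
    have a: "a (cs w) = cl (q w)" if "w \<in> S" for w
      unfolding a_def using inj that by (simp add: the_inv_into_f_f)
    have "x = lincomb a (cs ` S)"
      using lincomb_cs[where a = a and q = q, OF S(1) SN inj a] v S(3) cs_eq[OF v(1) sum_in_N[OF SN]] by simp
    moreover have "a \<in> cs ` S \<rightarrow> carrier K" using a by (auto simp: carrier_K)
    moreover have "finite (cs ` S)" "cs ` S \<subseteq> cs ` R" using S by auto
    ultimately show "x \<in> span (cs ` R)" unfolding span_def by blast
  qed
  ultimately show "basis (cs ` R)"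
    unfolding basis_def using span_is_subset2[of "cs ` R"] assms(1)
    by (metis carrier_V image_mono subset_antisym)
next
  assume B: "basis (cs ` R)"
  show "rep_basis act N D p R"
    unfolding rep_basis_def
  proof (intro conjI ballI allI impI)
    fix v assume v: "v \<in> N"
    then have "cs v \<in> span (cs ` R)" using B unfolding basis_def by (auto simp: carrier_V)
    then obtain A a where A: "finite A" "A \<subseteq> cs ` R" "a \<in> A \<rightarrow> carrier K" "cs v = lincomb a A"
      unfolding span_def by blast
    obtain S where S: "finite S" "S \<subseteq> R" "A = cs ` S" "inj_on cs S"
      using subset_cs_imageE[OF A(1,2)] .
    have "\<forall>v\<in>S. \<exists>r. a (cs v) = cl r" using A(3) S(3) by (auto simp: carrier_K Pi_def)
    then obtain q where q: "\<And>v. v \<in> S \<Longrightarrow> a (cs v) = cl (q v)" by metis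
    have SN: "S \<subseteq> N" using S assms by auto
    have "cs v = cs (\<Sum>v\<in>S. act (q v) v)" using lincomb_cs[where a = a and q = q, OF S(1) SN S(4) q] A(4) S(3) by simp
    then have "v - (\<Sum>v\<in>S. act (q v) v) \<in> D" using cs_eq sum_in_N[OF SN] v by blast
    then show "\<exists>S q. finite S \<and> S \<subseteq> R \<and> v - (\<Sum>b\<in>S. act (q b) b) \<in> D" using S by blast
  next
    fix S q b assume S: "finite S" "S \<subseteq> R" "(\<Sum>b\<in>S. act (q b) b) \<in> D" and b: "b \<in> S"
    have SN: "S \<subseteq> N" and inj: "inj_on cs S" using S assms inj_on_subset by auto
    define a where "a = (\<lambda>y. cl (q (the_inv_into S cs y)))"
    have a: "a (cs w) = cl (q w)" if "w \<in> S" for w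
      unfolding a_def using inj that by (simp add: the_inv_into_f_f)
    have "lincomb a (cs ` S) = \<zero>\<^bsub>V\<^esub>"
      using lincomb_cs[where a = a and q = q, OF S(1) SN inj a] cs_eq_zero[OF sum_in_N[OF SN]] S(3) by simp
    moreover have "a \<in> cs ` S \<rightarrow> carrier K" using a by (auto simp: carrier_K)
    moreover have "finite (cs ` S)" "cs ` S \<subseteq> cs ` R" "cs b \<in> cs ` S" using S b by auto
    ultimately have "a (cs b) = \<zero>\<^bsub>K\<^esub>"
      using B unfolding basis_def lin_dep_def by blast
    then show "p dvd q b" using a[OF b] cl_eq_zero by simp
  qed (use assms in blast)
qed

lemma basis_imp_rep_basis:
  assumes "basis B"
  obtains R where "rep_basis act N D p R" "inj_on cs R" "B = cs ` R"
proof -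
  have "B \<subseteq> cs ` N" using assms by (simp add: basis_def carrier_V)
  then obtain R where "R \<subseteq> N" "inj_on cs R" "B = cs ` R" by (metis subset_image_inj)
  then show thesis using that rep_basis_iff_basis assms by blast
qed

end

subsection \<open>Decompositions into cyclic modules\<close>

text \<open>Coprimality in Bezout form: the factors \<open>s\<close> and \<open>t\<close> are what
  later splits a vector into components.\<close>

definition comaximal :: "'r::comm_ring_1 \<Rightarrow> 'r \<Rightarrow> bool" where
  "comaximal a b \<longleftrightarrow> (\<exists>s t. s * a + t * b = 1)"

lemma comaximal_sym: "comaximal a b \<Longrightarrow> comaximal b a"
  unfolding comaximal_def by (metis add.commute)

lemma comaximal_1: "comaximal a 1"
  unfolding comaximal_def by (rule exI[of _ 0], rule exI[of _ 1]) simp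

text \<open>In the product of the two Bezout identities every term except
  \<open>t * b * t' * c\<close> contains \<open>a\<close>.\<close>

lemma comaximal_mult:
  assumes "comaximal a b" "comaximal a c"
  shows "comaximal a (b * c)"
proof -
  obtain s t s' t' where "s * a + t * b = 1" "s' * a + t' * c = 1"
    using assms unfolding comaximal_def by blast
  then have "(s * a + t * b) * (s' * a + t' * c) = 1" by simp
  then have "(s * s' * a + s * t' * c + t * b * s') * a + (t * t') * (b * c) = 1"
    by (simp add: algebra_simps)
  then show ?thesis unfolding comaximal_def by blast
qed

lemma comaximal_prod: "(\<And>j. j \<in> J \<Longrightarrow> comaximal a (c j)) \<Longrightarrow> comaximal a (\<Prod>j\<in>J. c j)"
  by (induction J rule: infinite_finite_induct) (auto intro: comaximal_1 comaximal_mult)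

lemma comaximal_power: "comaximal a b \<Longrightarrow> comaximal (a ^ m) (b ^ n)"
proof -
  have *: "comaximal a b \<Longrightarrow> comaximal a (b ^ n)" for a b :: 'a and n
    by (induction n) (auto intro: comaximal_1 comaximal_mult)
  assume "comaximal a b"
  then show ?thesis by (intro *) (metis * comaximal_sym)
qed

text \<open>With \<open>decomposable_part\<close>, this is the form over any commutative ring of the
  sets that define \<open>nu\<close>; \<open>ker_pow_eq\<close> and \<open>nu_denominator_eq\<close>
  make the identification.\<close>

definition power_kernel :: "('r::comm_ring_1 \<Rightarrow> 'v::ab_group_add \<Rightarrow> 'v) \<Rightarrow> 'r \<Rightarrow> nat \<Rightarrow> 'v set" where
  "power_kernel act p i = {v. act (p ^ i) v = 0}"

definition decomposable_part :: "('r::comm_ring_1 \<Rightarrow> 'v::ab_group_add \<Rightarrow> 'v) \<Rightarrow> 'r \<Rightarrow> nat \<Rightarrow> 'v set" where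
  "decomposable_part act p i =
     {u + act p w | u w. u \<in> power_kernel act p (i - 1) \<and> w \<in> power_kernel act p (i + 1)}"

text \<open>An internal direct sum of cyclic submodules, expressed by finite sums. With the first
  clause, the last one gives the annihilator of \<open>x i\<close> when \<open>S\<close> is a
  singleton, and directness in general. Families are used so that two modules can share the index
  set and the orders.\<close>

definition cyclic_decomp ::
    "('r::comm_ring_1 \<Rightarrow> 'v::ab_group_add \<Rightarrow> 'v) \<Rightarrow> 'i set \<Rightarrow> ('i \<Rightarrow> 'v) \<Rightarrow> ('i \<Rightarrow> 'r) \<Rightarrow> bool" where
  "cyclic_decomp act I x ord \<longleftrightarrow>
     (\<forall>i\<in>I. act (ord i) (x i) = 0) \<and>
     (\<forall>v. \<exists>S q. finite S \<and> S \<subseteq> I \<and> v = (\<Sum>i\<in>S. act (q i) (x i))) \<and>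
     (\<forall>S q. finite S \<longrightarrow> S \<subseteq> I \<longrightarrow> (\<Sum>i\<in>S. act (q i) (x i)) = 0 \<longrightarrow> (\<forall>i\<in>S. ord i dvd q i))"

lemma cyclic_decompD:
  assumes "cyclic_decomp act I x ord"
  shows "i \<in> I \<Longrightarrow> act (ord i) (x i) = 0"
    and "\<exists>S q. finite S \<and> S \<subseteq> I \<and> v = (\<Sum>i\<in>S. act (q i) (x i))"
    and "finite S \<Longrightarrow> S \<subseteq> I \<Longrightarrow> (\<Sum>i\<in>S. act (q i) (x i)) = 0 \<Longrightarrow> i \<in> S \<Longrightarrow> ord i dvd q i"
  using assms unfolding cyclic_decomp_def by blast+

lemma cyclic_decomp_reindex:
  assumes "cyclic_decomp act I' x ord" "bij_betw \<phi> I I'"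
  shows "cyclic_decomp act I (x \<circ> \<phi>) (ord \<circ> \<phi>)"
  unfolding cyclic_decomp_def
proof (intro conjI ballI allI impI)
  fix i assume "i \<in> I"
  then have "\<phi> i \<in> I'" using assms(2) bij_betwE by blast
  then show "act ((ord \<circ> \<phi>) i) ((x \<circ> \<phi>) i) = 0" using assms(1) by (simp add: cyclic_decomp_def)
next
  fix v
  obtain S q where S: "finite S" "S \<subseteq> I'" "v = (\<Sum>i\<in>S. act (q i) (x i))"
    using cyclic_decompD(2)[OF assms(1)] by blast
  have "S \<subseteq> \<phi> ` I" using S(2) assms(2) by (simp add: bij_betw_def)
  then obtain T where T: "T \<subseteq> I" "inj_on \<phi> T" "S = \<phi> ` T" by (metis subset_image_inj)
  then have "finite T" using S(1) finite_imageD by blast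
  moreover have "v = (\<Sum>i\<in>T. act ((q \<circ> \<phi>) i) ((x \<circ> \<phi>) i))"
    using S(3) T by (simp add: sum.reindex)
  ultimately show "\<exists>S q. finite S \<and> S \<subseteq> I \<and> v = (\<Sum>i\<in>S. act (q i) ((x \<circ> \<phi>) i))"
    using T(1) by blast
next
  fix S q i assume S: "finite S" "S \<subseteq> I" "(\<Sum>i\<in>S. act (q i) ((x \<circ> \<phi>) i)) = 0" "i \<in> S"
  have inj: "inj_on \<phi> S" using assms(2) S(2) by (metis bij_betw_def inj_on_subset)
  define q' where "q' = (\<lambda>j. q (the_inv_into S \<phi> j))"
  have q': "q' (\<phi> j) = q j" if "j \<in> S" for j
    using inj that by (simp add: q'_def the_inv_into_f_f)
  have "(\<Sum>j\<in>\<phi> ` S. act (q' j) (x j)) = 0"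
    using S(3) inj q' by (simp add: sum.reindex)
  moreover have "finite (\<phi> ` S)" "\<phi> ` S \<subseteq> I'"
    using S(1,2) assms(2) by (auto simp: bij_betw_def)
  ultimately have "ord (\<phi> i) dvd q' (\<phi> i)"
    using cyclic_decompD(3)[OF assms(1)] S(4) by blast
  then show "(ord \<circ> \<phi>) i dvd q i" using q' S(4) by simp
qed

context Modules.module begin

text \<open>For the linearity of the map in \<open>cyclic_decomp_iso\<close>: two vectors come with
  different finite supports, and their coefficients are extended by zero to the union.\<close>

lemma sum_scale_union:
  assumes "finite S" "finite T"
  shows "(\<Sum>i\<in>S \<union> T. scale (r * (if i \<in> S then q i else 0) + (if i \<in> T then q' i else 0)) (x i)) =
    scale r (\<Sum>i\<in>S. scale (q i) (x i)) + (\<Sum>i\<in>T. scale (q' i) (x i))"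
proof -
  have *: "(\<Sum>i\<in>A. scale (if i \<in> B then h i else 0) (x i)) = (\<Sum>i\<in>B. scale (h i) (x i))"
    if "finite A" "B \<subseteq> A" for A B h
    using that by (intro sum.mono_neutral_cong_right) auto
  have "(\<Sum>i\<in>S \<union> T. scale (r * (if i \<in> S then q i else 0) + (if i \<in> T then q' i else 0)) (x i)) =
    (\<Sum>i\<in>S \<union> T. scale r (scale (if i \<in> S then q i else 0) (x i)) + scale (if i \<in> T then q' i else 0) (x i))"
    by (simp only: scale_left_distrib scale_scale)
  also have "\<dots> = scale r (\<Sum>i\<in>S \<union> T. scale (if i \<in> S then q i else 0) (x i)) +
      (\<Sum>i\<in>S \<union> T. scale (if i \<in> T then q' i else 0) (x i))"
    by (simp only: sum.distrib scale_sum_right)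
  also have "\<dots> = scale r (\<Sum>i\<in>S. scale (q i) (x i)) + (\<Sum>i\<in>T. scale (q' i) (x i))"
    using assms * by simp
  finally show ?thesis .
qed

lemma span_image_sumE:
  assumes "v \<in> span (x ` I)"
  obtains S q where "finite S" "S \<subseteq> I" "v = (\<Sum>i\<in>S. scale (q i) (x i))"
proof -
  obtain T r where T: "finite T" "T \<subseteq> x ` I" "v = (\<Sum>a\<in>T. scale (r a) a)"
    using assms unfolding span_explicit by blast
  obtain S where S: "S \<subseteq> I" "inj_on x S" "T = x ` S" using T(2) by (metis subset_image_inj)
  show thesis
  proof (rule that)
    show "finite S" using S T finite_imageD by blast
    show "v = (\<Sum>i\<in>S. scale ((r \<circ> x) i) (x i))" using S T by (simp add: sum.reindex)
  qed (fact S(1))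
qed

end

text \<open>The isomorphism sends \<open>x i\<close> to \<open>x' i\<close>. Coefficients are
  determined only modulo the orders, so it starts as a relation \<open>T\<close>, closed under
  linear combinations. Single-valuedness and injectivity reduce to pairs with a zero component,
  where the equality of the orders decides.\<close>

lemma cyclic_decomp_iso:
  assumes "Modules.module act" "Modules.module act'"
    and d: "cyclic_decomp act I x ord" and d': "cyclic_decomp act' I x' ord"
  obtains \<tau> where "bij \<tau>" "\<And>v w. \<tau> (v + w) = \<tau> v + \<tau> w" "\<And>q v. \<tau> (act q v) = act' q (\<tau> v)"
proof -
  interpret a: Modules.module act by fact
  interpret b: Modules.module act' by fact
  define T where "T v w \<longleftrightarrow> (\<exists>S q. finite S \<and> S \<subseteq> I \<and>
      v = (\<Sum>i\<in>S. act (q i) (x i)) \<and> w = (\<Sum>i\<in>S. act' (q i) (x' i)))" for v w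
  have lin: "T (act r v + v') (act' r w + w')" if "T v w" "T v' w'" for r v w v' w'
  proof -
    obtain S q where S: "finite S" "S \<subseteq> I" "v = (\<Sum>i\<in>S. act (q i) (x i))" "w = (\<Sum>i\<in>S. act' (q i) (x' i))"
      using \<open>T v w\<close> unfolding T_def by blast
    obtain S' q' where S': "finite S'" "S' \<subseteq> I" "v' = (\<Sum>i\<in>S'. act (q' i) (x i))"
        "w' = (\<Sum>i\<in>S'. act' (q' i) (x' i))"
      using \<open>T v' w'\<close> unfolding T_def by blast
    define h where "h i = r * (if i \<in> S then q i else 0) + (if i \<in> S' then q' i else 0)" for i
    have "act r v + v' = (\<Sum>i\<in>S \<union> S'. act (h i) (x i))"
      unfolding S(3) S'(3) h_def using a.sum_scale_union[OF S(1) S'(1)] by simp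
    moreover have "act' r w + w' = (\<Sum>i\<in>S \<union> S'. act' (h i) (x' i))"
      unfolding S(4) S'(4) h_def using b.sum_scale_union[OF S(1) S'(1)] by simp
    ultimately show ?thesis
      unfolding T_def using S S' by (intro exI[of _ "S \<union> S'"] exI[of _ h]) auto
  qed
  have kill: "w = 0" if T: "T v w" and v: "v = 0" for v w
  proof -
    obtain S q where S: "finite S" "S \<subseteq> I" "v = (\<Sum>i\<in>S. act (q i) (x i))" "w = (\<Sum>i\<in>S. act' (q i) (x' i))"
      using T unfolding T_def by blast
    have "act' (q i) (x' i) = 0" if "i \<in> S" for i
    proof -
      have "ord i dvd q i" using cyclic_decompD(3)[OF d S(1,2) S(3)[symmetric, unfolded v] that] .
      then obtain c where "q i = ord i * c" ..
      moreover have "act' (ord i) (x' i) = 0" using cyclic_decompD(1)[OF d'] S(2) that by blast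
      ultimately show ?thesis by (metis b.scale_scale b.scale_zero_right mult.commute)
    qed
    then show ?thesis using S(4) by simp
  qed
  have kill': "v = 0" if T: "T v w" and w: "w = 0" for v w
  proof -
    obtain S q where S: "finite S" "S \<subseteq> I" "v = (\<Sum>i\<in>S. act (q i) (x i))" "w = (\<Sum>i\<in>S. act' (q i) (x' i))"
      using T unfolding T_def by blast
    have "act (q i) (x i) = 0" if "i \<in> S" for i
    proof -
      have "ord i dvd q i" using cyclic_decompD(3)[OF d' S(1,2) S(4)[symmetric, unfolded w] that] .
      then obtain c where "q i = ord i * c" ..
      moreover have "act (ord i) (x i) = 0" using cyclic_decompD(1)[OF d] S(2) that by blast
      ultimately show ?thesis by (metis a.scale_scale a.scale_zero_right mult.commute)
    qed
    then show ?thesis using S(3) by simp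
  qed
  have total: "\<exists>w. T v w" for v using cyclic_decompD(2)[OF d, of v] unfolding T_def by blast
  have onto: "\<exists>v. T v w" for w using cyclic_decompD(2)[OF d', of w] unfolding T_def by blast
  \<comment> \<open>The difference of the two pairs is \<open>T 0 (w' - w)\<close>, to which
    \<open>kill\<close> applies.\<close>
  have functional: "w = w'" if "T v w" "T v w'" for v w w'
    using kill[OF lin[OF that, of "-1"]] by simp
  define \<tau> where "\<tau> v = (THE w. T v w)" for v
  have \<tau>: "T v (\<tau> v)" for v
    unfolding \<tau>_def using total functional by (metis theI)
  have \<tau>I: "\<tau> v = w" if "T v w" for v w using \<tau> that functional by blast
  have zero: "T 0 0" using lin[OF \<tau>[of 0] \<tau>[of 0], of "-1"] by simp
  show thesis
  proof (rule that[of \<tau>])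
    show "\<tau> (v + w) = \<tau> v + \<tau> w" for v w using \<tau>I lin[OF \<tau>[of v] \<tau>[of w], of 1] by simp
    show "\<tau> (act q v) = act' q (\<tau> v)" for q v using \<tau>I lin[OF \<tau>[of v] zero, of q] by simp
    show "bij \<tau>"
    proof (rule bijI)
      show "inj \<tau>"
      proof (rule injI)
        fix v w assume "\<tau> v = \<tau> w"
        then show "v = w" using kill'[OF lin[OF \<tau>[of v] \<tau>[of w], of "-1"]] by simp
      qed
      show "surj \<tau>" using onto \<tau>I by (metis surjI)
    qed
  qed
qed

subsection \<open>Primary modules\<close>

context Modules.module begin

lemma power_kernel_iff: "v \<in> power_kernel scale p i \<longleftrightarrow> scale (p ^ i) v = 0"
  by (simp add: power_kernel_def)

lemma subspace_power_kernel: "subspace (power_kernel scale p i)"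
  by (rule subspaceI)
    (simp_all add: power_kernel_iff scale_right_distrib scale_left_commute[of "p ^ i"] del: scale_scale)

text \<open>
  Descending induction on \<open>i\<close> gives \<open>ker p^i \<subseteq> W + ker p^(i-1)\<close> for the span \<open>W\<close>: the summand
  \<open>p ker p^(i+1)\<close> of the denominator lies in \<open>p W + p ker p^i\<close>. The kernels are then absorbed into
  \<open>W\<close> from the bottom up.
\<close>

lemma span_contains_power_kernel:
  assumes rep: "\<And>i. i \<in> {1..n} \<Longrightarrow>
      rep_basis scale (power_kernel scale p i) (decomposable_part scale p i) p (R i)"
    and top: "power_kernel scale p (Suc n) \<subseteq> power_kernel scale p n"
  shows "power_kernel scale p n \<subseteq> span (\<Union>i\<in>{1..n}. R i)"
proof -
  define W where "W = span (\<Union>i\<in>{1..n}. R i)"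
  let ?K = "power_kernel scale p"
  have step: "\<exists>w\<in>W. v - w \<in> ?K (i - 1)" if "v \<in> ?K i" "i \<le> Suc n" "1 \<le> i" for v i
    using that(2,3,1)
  proof (induction i arbitrary: v rule: inc_induct)
    \<comment> \<open>The kernels do not grow beyond exponent \<open>n\<close>, so
      \<open>w = 0\<close> will do.\<close>
    case base
    then have "v - 0 \<in> ?K (Suc n - 1)" using top by auto
    then show ?case using span_zero[of "\<Union>i\<in>{1..n}. R i"] unfolding W_def by blast
  next
    case (step i)
    have "i \<in> {1..n}" using step by auto
    then have r: "rep_basis scale (?K i) (decomposable_part scale p i) p (R i)" by (rule rep)
    then obtain S q where S: "S \<subseteq> R i" "v - (\<Sum>b\<in>S. scale (q b) b) \<in> decomposable_part scale p i"
      using step.prems(2) unfolding rep_basis_def by meson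
    define s where "s = (\<Sum>b\<in>S. scale (q b) b)"
    have "s \<in> W" unfolding s_def W_def
      using S(1) \<open>i \<in> {1..n}\<close> by (intro span_sum span_scale span_base) auto
    obtain u y where u: "v - s = u + scale p y" "u \<in> ?K (i - 1)" "y \<in> ?K (Suc i)"
      using S(2) unfolding decomposable_part_def s_def[symmetric] by auto
    obtain w where w: "w \<in> W" "y - w \<in> ?K i" using step.IH[of y] u(3) by auto
    have "scale p (y - w) \<in> ?K (i - 1)"
      using w(2) step.prems(1) by (simp add: power_kernel_iff power_Suc2[symmetric] del: power_Suc)
    then have "u + scale p (y - w) \<in> ?K (i - 1)"
      using u(2) subspace_add[OF subspace_power_kernel] by blast
    moreover have "u + scale p (y - w) = v - (s + scale p w)"
      using u(1) by (simp add: algebra_simps)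
    moreover have "s + scale p w \<in> W"
      using \<open>s \<in> W\<close> w(1) unfolding W_def by (intro span_add span_scale)
    ultimately show ?case by metis
  qed
  have "?K i \<subseteq> W" if "i \<le> n" for i
    using that
  proof (induction i)
    case 0
    then show ?case unfolding W_def by (auto simp: power_kernel_iff span_zero)
  next
    case (Suc i)
    show ?case
    proof
      fix v assume "v \<in> ?K (Suc i)"
      then obtain w where "w \<in> W" "v - w \<in> ?K i" using step[of v "Suc i"] Suc.prems by auto
      then have "(v - w) + w \<in> W" using Suc unfolding W_def by (intro span_add) auto
      then show "v \<in> W" by simp
    qed
  qed
  then show ?thesis unfolding W_def by blast
qed

text \<open>
  For the least exponent \<open>i\<close> that occurs with \<open>p\<close> not dividing \<open>u\<close>, the terms with larger exponents are
  \<open>p^(i-1)\<close> times an element of \<open>p ker p^(i+1)\<close>, so the terms with exponent \<open>i\<close> sum up to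
  an element of the denominator.
\<close>

lemma socle_independent:
  assumes rep: "\<And>i. i \<in> {1..n} \<Longrightarrow>
      rep_basis scale (power_kernel scale p i) (decomposable_part scale p i) p (R i)"
    and S: "finite S" "S \<subseteq> (SIGMA i:{1..n}. R i)"
    and zero: "(\<Sum>z\<in>S. scale (p ^ (fst z - 1) * u z) (snd z)) = 0"
    and z: "z \<in> S"
  shows "p dvd u z"
  using z
proof (induction "fst z" arbitrary: z rule: less_induct)
  case less
  define i where "i = fst z"
  have i: "i \<in> {1..n}" using less.prems S(2) by (auto simp: i_def)
  let ?K = "power_kernel scale p"
  have ker: "scale (p ^ fst y) (snd y) = 0" if "y \<in> S" for y
  proof -
    have "fst y \<in> {1..n}" "snd y \<in> R (fst y)" using that S(2) by auto
    then have "snd y \<in> ?K (fst y)" using rep_basis_subset[OF rep] by blast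
    then show ?thesis by (simp add: power_kernel_iff)
  qed
  have pos: "fst y \<ge> 1" if "y \<in> S" for y using that S(2) by auto
  define A where "A = {y\<in>S. fst y = i}"
  define B where "B = {y\<in>S. i < fst y}"
  let ?t = "\<lambda>y. scale (p ^ (fst y - 1) * u y) (snd y)"
  have "(\<Sum>y\<in>S. ?t y) = (\<Sum>y\<in>A \<union> B. ?t y)"
  proof (rule sum.mono_neutral_right)
    \<comment> \<open>The exponent is below \<open>i\<close> here. By induction \<open>p\<close>
      divides \<open>u y\<close>, which completes \<open>p ^ (fst y - 1)\<close> to the power that
      annihilates \<open>snd y\<close>.\<close>
    show "\<forall>y\<in>S - (A \<union> B). ?t y = 0"
    proof
      fix y assume "y \<in> S - (A \<union> B)"
      then have y: "y \<in> S" "fst y < i" by (auto simp: A_def B_def)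
      then obtain c where c: "u y = p * c" using less.hyps[of y] by (auto simp: i_def)
      have "p ^ (fst y - 1) * u y = c * p ^ fst y"
        using pos[OF y(1)] by (simp add: c power_eq_if)
      then show "?t y = 0" using ker[OF y(1)] by (metis scale_scale scale_zero_right)
    qed
  qed (use S in \<open>auto simp: A_def B_def\<close>)
  also have "\<dots> = (\<Sum>y\<in>A. ?t y) + (\<Sum>y\<in>B. ?t y)"
    using S(1) by (intro sum.union_disjoint) (auto simp: A_def B_def)
  finally have sum0: "(\<Sum>y\<in>A. ?t y) + (\<Sum>y\<in>B. ?t y) = 0" using zero by simp
  \<comment> \<open>With \<open>p ^ (i - 1)\<close> taken out, the relation says that this power
    annihilates \<open>s + p y0\<close>. The truncated exponent in \<open>y0\<close> is exact
    because \<open>i < fst y\<close> on \<open>B\<close>.\<close>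
  define s where "s = (\<Sum>y\<in>A. scale (u y) (snd y))"
  define y0 where "y0 = (\<Sum>y\<in>B. scale (p ^ (fst y - 1 - i) * u y) (snd y))"
  have "(\<Sum>y\<in>A. ?t y) = scale (p ^ (i - 1)) s"
    unfolding s_def scale_sum_right by (rule sum.cong) (auto simp: A_def)
  moreover have "(\<Sum>y\<in>B. ?t y) = scale (p ^ (i - 1)) (scale p y0)"
    unfolding y0_def scale_sum_right
  proof (rule sum.cong)
    fix y assume "y \<in> B"
    then have "fst y - 1 = (i - 1) + Suc (fst y - 1 - i)" using i by (auto simp: B_def)
    then have "p ^ (fst y - 1) = p ^ (i - 1) * (p * p ^ (fst y - 1 - i))"
      by (metis power_add power_Suc)
    then show "?t y = scale (p ^ (i - 1)) (scale p (scale (p ^ (fst y - 1 - i) * u y) (snd y)))"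
      by (simp add: mult.assoc)
  qed simp
  ultimately have "s + scale p y0 \<in> ?K (i - 1)"
    using sum0 by (simp add: power_kernel_iff scale_right_distrib)
  moreover have "- y0 \<in> ?K (i + 1)"
  proof -
    have "scale (p ^ (i + 1)) (scale (p ^ (fst y - 1 - i) * u y) (snd y)) = 0" if "y \<in> B" for y
    proof -
      have "(i + 1) + (fst y - 1 - i) = fst y" using that by (auto simp: B_def)
      then have "p ^ (i + 1) * p ^ (fst y - 1 - i) = p ^ fst y" by (metis power_add)
      then have "p ^ (i + 1) * (p ^ (fst y - 1 - i) * u y) = u y * p ^ fst y"
        by (metis mult.assoc mult.commute)
      moreover have "y \<in> S" using that by (simp add: B_def)
      ultimately show ?thesis using ker[of y] by (metis scale_scale scale_zero_right)
    qed
    then have "scale (p ^ (i + 1)) y0 = 0" unfolding y0_def scale_sum_right by (intro sum.neutral) blast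
    then show ?thesis by (simp add: power_kernel_iff)
  qed
  moreover have "s = (s + scale p y0) + scale p (- y0)" by simp
  ultimately have sD: "s \<in> decomposable_part scale p i"
    unfolding decomposable_part_def by blast
  \<comment> \<open>With the exponent fixed to \<open>i\<close>, pairs correspond to vectors, and
    \<open>rep_basis\<close> speaks of sums over sets of vectors.\<close>
  have A: "A = Pair i ` (snd ` A)" by (force simp: A_def)
  have inj: "inj_on snd A" by (auto simp: inj_on_def A_def prod_eq_iff)
  have "s = (\<Sum>b\<in>snd ` A. scale (u (i, b)) b)"
    unfolding s_def sum.reindex[OF inj] by (rule sum.cong) (auto simp: A_def)
  then have "(\<Sum>b\<in>snd ` A. scale (u (i, b)) b) \<in> decomposable_part scale p i" using sD by simp
  moreover have "finite (snd ` A)" "snd ` A \<subseteq> R i" "snd z \<in> snd ` A"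
    using S less.prems by (auto simp: A_def i_def)
  ultimately have "p dvd u (i, snd z)" using rep_basisD[OF rep[OF i], of "snd ` A" "\<lambda>b. u (i, b)" "snd z"] by blast
  then show ?case by (simp add: i_def)
qed

text \<open>
  A relation annihilated termwise by \<open>p^(h+1)\<close> becomes, after multiplication by \<open>p^h\<close>, a relation
  in the socle.
\<close>

lemma primary_independent:
  assumes p: "\<And>a b. p * a dvd p * b \<Longrightarrow> a dvd b"
    and rep: "\<And>i. i \<in> {1..n} \<Longrightarrow>
      rep_basis scale (power_kernel scale p i) (decomposable_part scale p i) p (R i)"
    and S: "finite S" "S \<subseteq> (SIGMA i:{1..n}. R i)"
    and zero: "(\<Sum>z\<in>S. scale (q z) (snd z)) = 0"
    and z: "z \<in> S"
  shows "p ^ fst z dvd q z"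
proof -
  have "\<forall>z\<in>S. p ^ fst z dvd q z" if "\<forall>z\<in>S. p ^ fst z dvd p ^ h * q z" for h
    using that
  proof (induction h)
    case (Suc h)
    \<comment> \<open>Cancelling one \<open>p\<close> leaves only the exponent
      \<open>fst z - 1\<close>; the missing factor is regained from \<open>u z\<close> by
      \<open>socle_independent\<close>.\<close>
    have "\<exists>u. p ^ h * q z = p ^ (fst z - 1) * u" if "z \<in> S" for z
    proof -
      have "fst z \<ge> 1" using that S(2) by auto
      then have "p ^ fst z = p * p ^ (fst z - 1)" by (cases "fst z") simp_all
      then have "p * p ^ (fst z - 1) dvd p * (p ^ h * q z)"
        using bspec[OF Suc.prems that] by (simp add: mult.assoc)
      then show ?thesis using p by (simp add: dvd_def)
    qed
    then obtain u where u: "\<And>z. z \<in> S \<Longrightarrow> p ^ h * q z = p ^ (fst z - 1) * u z" by metis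
    have "(\<Sum>z\<in>S. scale (p ^ (fst z - 1) * u z) (snd z)) = scale (p ^ h) (\<Sum>z\<in>S. scale (q z) (snd z))"
      unfolding scale_sum_right by (rule sum.cong) (auto simp: u)
    then have sz: "(\<Sum>z\<in>S. scale (p ^ (fst z - 1) * u z) (snd z)) = 0" using zero by simp
    have "p ^ fst z dvd p ^ h * q z" if zS: "z \<in> S" for z
    proof -
      have "p dvd u z" using socle_independent[OF rep S sz zS] by simp
      moreover have "fst z \<ge> 1" using zS S(2) by auto
      then have "p ^ fst z = p ^ (fst z - 1) * p" by (cases "fst z") (simp_all add: mult.commute)
      ultimately show ?thesis using u[OF zS] by (simp add: mult_dvd_mono)
    qed
    then show ?case using Suc.IH by blast
  qed simp
  \<comment> \<open>The descent in \<open>h\<close> can start at \<open>n\<close>, since no exponent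
    exceeds \<open>n\<close>.\<close>
  moreover have "\<forall>z\<in>S. p ^ fst z dvd p ^ n * q z"
  proof
    fix z assume "z \<in> S"
    then have "fst z \<le> n" using S(2) by auto
    then show "p ^ fst z dvd p ^ n * q z" by (simp add: le_imp_power_dvd)
  qed
  ultimately show ?thesis using z by blast
qed

text \<open>Let \<open>C\<close> be the product of the factors other than \<open>c a\<close>, and
  \<open>s * c a + t * C = 1\<close>. Then \<open>v\<close> is the sum of \<open>s * c a\<close>
  applied to \<open>v\<close>, which \<open>C\<close> annihilates, and \<open>t * C\<close> applied
  to \<open>v\<close>, which \<open>c a\<close> annihilates. The induction hypothesis treats the
  first summand.\<close>

lemma comaximal_kernels_span:
  assumes "finite J" "\<And>j k. j \<in> J \<Longrightarrow> k \<in> J \<Longrightarrow> j \<noteq> k \<Longrightarrow> comaximal (c j) (c k)"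
    and "scale (\<Prod>j\<in>J. c j) v = 0"
  shows "v \<in> span (\<Union>j\<in>J. {w. scale (c j) w = 0})"
  using assms
proof (induction J arbitrary: v)
  case empty
  then show ?case by simp
next
  case (insert a J)
  let ?C = "\<Prod>j\<in>J. c j"
  have "comaximal (c a) ?C" by (rule comaximal_prod) (use insert in auto)
  then obtain s t where st: "s * c a + t * ?C = 1" unfolding comaximal_def by blast
  have "v = scale (s * c a + t * ?C) v" by (simp add: st)
  then have v: "v = scale (s * c a) v + scale (t * ?C) v" by (simp add: scale_left_distrib)
  have aC: "scale (c a * ?C) v = 0" using insert.prems(2) insert.hyps by simp
  have "scale ?C (scale (s * c a) v) = scale s (scale (c a * ?C) v)" by (simp add: mult_ac)
  then have "scale (s * c a) v \<in> span (\<Union>j\<in>J. {w. scale (c j) w = 0})"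
    using aC insert by (intro insert.IH) auto
  then have 1: "scale (s * c a) v \<in> span (\<Union>j\<in>insert a J. {w. scale (c j) w = 0})"
    by (rule subsetD[OF span_mono, rotated]) auto
  have "scale (c a) (scale (t * ?C) v) = scale t (scale (c a * ?C) v)" by (simp add: mult_ac)
  then have 2: "scale (t * ?C) v \<in> span (\<Union>j\<in>insert a J. {w. scale (c j) w = 0})"
    using aC by (intro span_base) auto
  show ?case by (subst v) (rule span_add[OF 1 2])
qed

text \<open>The component \<open>w j\<close> is annihilated by \<open>c j\<close> and, being minus
  the sum of the others, by the product of the other factors. The Bezout identity then makes it
  zero.\<close>

lemma comaximal_kernels_independent:
  assumes "finite J" "\<And>j k. j \<in> J \<Longrightarrow> k \<in> J \<Longrightarrow> j \<noteq> k \<Longrightarrow> comaximal (c j) (c k)"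
    and "\<And>j. j \<in> J \<Longrightarrow> scale (c j) (w j) = 0" and "(\<Sum>j\<in>J. w j) = 0" and "j \<in> J"
  shows "w j = 0"
proof -
  let ?C = "\<Prod>k\<in>J - {j}. c k"
  have "comaximal (c j) ?C" by (rule comaximal_prod) (use assms in auto)
  then obtain s t where st: "s * c j + t * ?C = 1" unfolding comaximal_def by blast
  have "scale ?C (w k) = 0" if k: "k \<in> J - {j}" for k
  proof -
    have "?C = (\<Prod>l\<in>J - {j} - {k}. c l) * c k"
      using prod.remove[of "J - {j}" k c] assms(1) k by (simp add: mult.commute)
    then show ?thesis using assms(3)[of k] k by (metis DiffD1 scale_scale scale_zero_right)
  qed
  then have "scale ?C (\<Sum>k\<in>J - {j}. w k) = 0" unfolding scale_sum_right by (rule sum.neutral[OF ballI])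
  moreover have "w j = - (\<Sum>k\<in>J - {j}. w k)"
    using sum.remove[OF assms(1,5), of w] assms(4) by (simp add: eq_neg_iff_add_eq_0)
  ultimately have "scale ?C (w j) = 0" by simp
  then have "scale (s * c j + t * ?C) (w j) = 0"
    using assms(3)[OF assms(5)] by (metis add.right_neutral scale_left_distrib scale_scale scale_zero_right)
  then show ?thesis by (simp add: st)
qed

text \<open>An index records the factor \<open>j\<close>, the exponent \<open>i\<close> and the
  generator itself. Comaximality reduces both generation and independence to a single
  \<open>j\<close>.\<close>

lemma primary_cyclic_decomp:
  assumes J: "finite J"
    and cancel: "\<And>j a b. j \<in> J \<Longrightarrow> p j * a dvd p j * b \<Longrightarrow> a dvd b"
    and com: "\<And>j k. j \<in> J \<Longrightarrow> k \<in> J \<Longrightarrow> j \<noteq> k \<Longrightarrow> comaximal (p j) (p k)"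
    and kill: "\<And>v. scale (\<Prod>j\<in>J. p j ^ n j) v = 0"
    and rep: "\<And>j i. j \<in> J \<Longrightarrow> i \<in> {1..n j} \<Longrightarrow>
      rep_basis scale (power_kernel scale (p j) i) (decomposable_part scale (p j) i) (p j) (R j i)"
  shows "cyclic_decomp scale (SIGMA j:J. SIGMA i:{1..n j}. R j i) (\<lambda>z. snd (snd z))
    (\<lambda>z. p (fst z) ^ fst (snd z))"
proof -
  let ?I = "SIGMA j:J. SIGMA i:{1..n j}. R j i" and ?x = "\<lambda>z. snd (snd z)"
  have com': "comaximal (p j ^ n j) (p k ^ n k)" if "j \<in> J" "k \<in> J" "j \<noteq> k" for j k
    using com[OF that] by (rule comaximal_power)
  have ker: "scale (p j ^ i) b = 0" if "(j, i, b) \<in> ?I" for j i b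
    using rep_basis_subset[OF rep, of j i] that by (auto simp: power_kernel_iff)
  have "{w. scale (p j ^ n j) w = 0} \<subseteq> span (?x ` ?I)" if j: "j \<in> J" for j
  proof -
    \<comment> \<open>Exponents above \<open>n j\<close> add nothing: by a Bezout identity for
      \<open>p j\<close> and the remaining factors, \<open>p j ^ n j\<close> is a combination of
      \<open>p j ^ Suc (n j)\<close> and the product of all factors, which acts as zero.\<close>
    have "power_kernel scale (p j) (Suc (n j)) \<subseteq> power_kernel scale (p j) (n j)"
    proof
      fix v assume "v \<in> power_kernel scale (p j) (Suc (n j))"
      then have v: "scale (p j ^ Suc (n j)) v = 0" by (simp only: power_kernel_iff)
      let ?C = "\<Prod>k\<in>J - {j}. p k ^ n k"
      have "comaximal (p j ^ 1) (p k ^ n k)" if "k \<in> J - {j}" for k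
        using com[of j k] j that by (intro comaximal_power) auto
      then have "comaximal (p j) ?C" by (intro comaximal_prod) simp
      then obtain s t where st: "s * p j + t * ?C = 1" unfolding comaximal_def by blast
      have "scale (p j ^ n j) v = scale (p j ^ n j * (s * p j + t * ?C)) v" by (simp add: st)
      also have "p j ^ n j * (s * p j + t * ?C) = s * p j ^ Suc (n j) + t * (\<Prod>k\<in>J. p k ^ n k)"
        by (simp add: prod.remove[OF J j] algebra_simps)
      also have "scale \<dots> v = scale s (scale (p j ^ Suc (n j)) v) + scale t (scale (\<Prod>k\<in>J. p k ^ n k) v)"
        by (simp only: scale_left_distrib scale_scale)
      also have "\<dots> = 0" by (simp only: v kill) simp
      finally show "v \<in> power_kernel scale (p j) (n j)" by (simp add: power_kernel_iff)
    qed
    then have "power_kernel scale (p j) (n j) \<subseteq> span (\<Union>i\<in>{1..n j}. R j i)"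
      using rep[OF j] by (intro span_contains_power_kernel) auto
    also have "\<dots> \<subseteq> span (?x ` ?I)" using j by (intro span_mono) force
    finally show ?thesis by (auto simp: power_kernel_iff)
  qed
  then have "span (\<Union>j\<in>J. {w. scale (p j ^ n j) w = 0}) \<subseteq> span (?x ` ?I)"
    by (intro span_minimal subspace_span) blast
  then have gen: "v \<in> span (?x ` ?I)" for v
    using comaximal_kernels_span[where c = "\<lambda>j. p j ^ n j", OF J com' kill, of v] by blast
  show ?thesis
    unfolding cyclic_decomp_def
  proof (intro conjI ballI allI impI)
    fix z assume "z \<in> ?I"
    then show "scale (p (fst z) ^ fst (snd z)) (snd (snd z)) = 0" using ker by auto
  next
    fix v
    obtain S q where S: "finite S" "S \<subseteq> ?I" "v = (\<Sum>z\<in>S. scale (q z) (?x z))"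
      by (rule span_image_sumE[OF gen[of v]])
    show "\<exists>S q. finite S \<and> S \<subseteq> ?I \<and> v = (\<Sum>z\<in>S. scale (q z) (?x z))"
      by (intro exI[of _ S] exI[of _ q] conjI) (fact S)+
  next
    fix S q z assume S: "finite S" "S \<subseteq> ?I" "(\<Sum>z\<in>S. scale (q z) (?x z)) = 0" "z \<in> S"
    \<comment> \<open>\<open>T j\<close> is the part of the relation that belongs to
      \<open>j\<close>. Its sum \<open>w j\<close> is annihilated by \<open>p j ^ n j\<close>, so
      each \<open>w j\<close> vanishes separately.\<close>
    define T where "T j = {y. (j, y) \<in> S}" for j
    have Seq: "S = (SIGMA j:J. T j)" using S(2) by (auto simp: T_def)
    have finT: "finite (T j)" for j
    proof -
      have "T j \<subseteq> snd ` S" by (force simp: T_def)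
      then show ?thesis using S(1) finite_subset by blast
    qed
    have TR: "T j \<subseteq> (SIGMA i:{1..n j}. R j i)" for j using S(2) by (auto simp: T_def)
    define w where "w j = (\<Sum>y\<in>T j. scale (q (j, y)) (snd y))" for j
    have sum0: "(\<Sum>j\<in>J. w j) = 0"
      using S(3) J finT unfolding Seq w_def by (simp add: sum.Sigma split_def)
    have "scale (p j ^ n j) (w j) = 0" if j: "j \<in> J" for j
      unfolding w_def scale_sum_right
    proof (rule sum.neutral[OF ballI])
      fix y assume y: "y \<in> T j"
      then have "(j, fst y, snd y) \<in> ?I" using TR j by auto
      then have "scale (p j ^ fst y) (snd y) = 0" by (rule ker)
      moreover have "fst y \<le> n j" using subsetD[OF TR y] by auto
      then have "p j ^ n j = p j ^ (n j - fst y) * p j ^ fst y" by (simp add: power_add[symmetric])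
      then have "p j ^ n j * q (j, y) = (q (j, y) * p j ^ (n j - fst y)) * p j ^ fst y"
        by (simp add: mult_ac)
      ultimately show "scale (p j ^ n j) (scale (q (j, y)) (snd y)) = 0"
        by (metis scale_scale scale_zero_right)
    qed
    then have w0: "w j = 0" if "j \<in> J" for j
      using comaximal_kernels_independent[where c = "\<lambda>j. p j ^ n j", OF J com' _ sum0 that] by blast
    obtain j y where z: "z = (j, y)" "j \<in> J" "y \<in> T j" using S(4) Seq by blast
    have "p j ^ fst y dvd q (j, y)"
      using primary_independent[OF cancel[OF z(2)] rep[OF z(2)] finT TR w0[OF z(2), unfolded w_def] z(3)]
      by simp
    then show "p (fst z) ^ fst (snd z) dvd q z" by (simp add: z)
  qed
qed

end

subsection \<open>Polynomials over a field and their action\<close>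

lemma monic_degree_0_eq_1:
  fixes a :: "'a::comm_semiring_1 poly"
  assumes "lead_coeff a = 1" "degree a = 0"
  shows "a = 1"
  using assms(2) by (rule degree_eq_zeroE) (use assms(1) in \<open>simp add: one_pCons\<close>)

lemma monic_dvd_antisym:
  fixes p q :: "'k::field poly"
  assumes "lead_coeff p = 1" "lead_coeff q = 1" "p dvd q" "q dvd p"
  shows "p = q"
proof -
  obtain c where c: "q = p * c" using assms(3) ..
  have "p \<noteq> 0" using assms(1) by auto
  then have "c dvd 1" using assms(4) unfolding c using dvd_times_left_cancel_iff[of p c 1] by simp
  moreover have lc: "lead_coeff c = 1" using assms(1,2) unfolding c by (simp add: lead_coeff_mult)
  then have "c \<noteq> 0" by auto
  ultimately have "c = 1" using lc by (intro monic_degree_0_eq_1) (simp_all add: is_unit_iff_degree)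
  then show ?thesis by (simp add: c)
qed

text \<open>Division with remainder: a nonzero element of least degree, made monic, divides every
  other, since a nonzero remainder would be an element of smaller degree.\<close>

lemma poly_ideal_monic_generator:
  fixes J :: "'k::field poly set"
  assumes "a \<in> J" "a \<noteq> 0"
    and add: "\<And>a b. a \<in> J \<Longrightarrow> b \<in> J \<Longrightarrow> a + b \<in> J"
    and mult: "\<And>r a. a \<in> J \<Longrightarrow> r * a \<in> J"
  obtains d where "lead_coeff d = 1" "J = {q. d dvd q}"
proof -
  obtain c where c: "c \<in> J" "c \<noteq> 0" "\<And>b. b \<in> J \<Longrightarrow> b \<noteq> 0 \<Longrightarrow> degree c \<le> degree b"
    using assms(1,2) ex_has_least_nat[of "\<lambda>b. b \<in> J \<and> b \<noteq> 0" a degree] by blast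
  define d where "d = Polynomial.smult (inverse (lead_coeff c)) c"
  have "d = [:inverse (lead_coeff c):] * c" by (simp add: d_def)
  then have dJ: "d \<in> J" using mult[OF c(1)] by metis
  have deg: "degree d = degree c" using c(2) by (simp add: d_def)
  have lc: "lead_coeff d = 1" using c(2) by (simp add: d_def)
  have "d dvd q" if q: "q \<in> J" for q
  proof (rule ccontr)
    assume "\<not> d dvd q"
    then have nz: "q mod d \<noteq> 0" by (simp add: mod_eq_0_iff_dvd)
    have "q mod d = q + (- (q div d)) * d" by (simp add: minus_div_mult_eq_mod[symmetric])
    then have "q mod d \<in> J" using add[OF q mult[OF dJ]] by metis
    then have "degree c \<le> degree (q mod d)" using c(3) nz by blast
    moreover have "d \<noteq> 0" using lc by auto
    then have "degree (q mod d) < degree d" using degree_mod_less[of d q] nz by simp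
    ultimately show False using deg by simp
  qed
  moreover have "q \<in> J" if "d dvd q" for q
    using that mult[OF dJ] by (metis dvd_def mult.commute)
  ultimately show thesis using lc by (intro that[of d]) auto
qed

text \<open>Let \<open>d\<close> generate the ideal of \<open>p\<close> and \<open>q\<close>, with
  \<open>p = d * e\<close>. If \<open>e\<close> were a unit, \<open>p\<close> would divide
  \<open>d\<close> and hence \<open>q\<close>; so irreducibility makes \<open>d\<close> a
  unit.\<close>

lemma irreducible_imp_comaximal:
  fixes p q :: "'k::field poly"
  assumes "irreducible p" "\<not> p dvd q"
  shows "comaximal p q"
proof -
  define J where "J = {s * p + t * q | s t. True}"
  have J: "s * p + t * q \<in> J" for s t by (auto simp: J_def)
  have pJ: "p \<in> J" using J[of 1 0] by simp
  have qJ: "q \<in> J" using J[of 0 1] by simp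
  have p0: "p \<noteq> 0" using assms(1) by auto
  have addJ: "a + b \<in> J" if a: "a \<in> J" and b: "b \<in> J" for a b
  proof -
    obtain s t where 1: "a = s * p + t * q" using a by (auto simp: J_def)
    obtain s' t' where 2: "b = s' * p + t' * q" using b by (auto simp: J_def)
    have "a + b = (s + s') * p + (t + t') * q" by (simp add: 1 2 algebra_simps)
    then show ?thesis using J by metis
  qed
  have multJ: "r * a \<in> J" if a: "a \<in> J" for r a
  proof -
    obtain s t where 1: "a = s * p + t * q" using a by (auto simp: J_def)
    have "r * a = (r * s) * p + (r * t) * q" by (simp add: 1 algebra_simps)
    then show ?thesis using J by metis
  qed
  obtain d where d: "J = {q. d dvd q}"
    using poly_ideal_monic_generator[OF pJ p0 addJ multJ] by metis
  then obtain e where e: "p = d * e" using pJ by (auto elim: dvdE)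
  have "\<not> e dvd 1"
  proof
    assume "e dvd 1"
    then have "p dvd d" unfolding e by (simp add: mult_unit_dvd_iff)
    then show False using qJ d assms(2) dvd_trans by blast
  qed
  then have "d dvd 1" using assms(1) e irreducibleD by blast
  then have "1 \<in> J" using d by simp
  then show ?thesis by (auto simp: J_def comaximal_def)
qed

lemma monic_irreducible_dvd_imp_eq:
  fixes p q :: "'k::field poly"
  assumes "irreducible p" "irreducible q" "lead_coeff p = 1" "lead_coeff q = 1" "p dvd q"
  shows "p = q"
proof -
  obtain c where c: "q = p * c" using assms(5) ..
  then have "c dvd 1" using assms(1,2) irreducibleD irreducible_not_unit by blast
  then have "q dvd p" unfolding c by (simp add: mult_unit_dvd_iff)
  then show ?thesis using assms by (intro monic_dvd_antisym)
qed

text \<open>A nonconstant divisor of least degree cannot split further; scaling makes it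
  monic.\<close>

lemma monic_irreducible_divisor:
  fixes a :: "'k::field poly"
  assumes "degree a > 0"
  obtains p where "lead_coeff p = 1" "irreducible p" "p dvd a"
proof -
  obtain c where c: "c dvd a" "degree c > 0"
      "\<And>b. b dvd a \<Longrightarrow> degree b > 0 \<Longrightarrow> degree c \<le> degree b"
    using ex_has_least_nat[of "\<lambda>b. b dvd a \<and> degree b > 0" a degree] assms by auto
  define p where "p = Polynomial.smult (inverse (lead_coeff c)) c"
  have c0: "c \<noteq> 0" using c(2) by auto
  then have lc: "lead_coeff p = 1" and deg: "degree p = degree c" by (simp_all add: p_def)
  have pa: "p dvd a" using c(1) c0 by (simp add: p_def smult_dvd_iff)
  have a0: "a \<noteq> 0" using assms by auto
  have "irreducible p"
  proof (rule irreducibleI)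
    show "p \<noteq> 0" using lc by auto
    show "\<not> p dvd 1" using deg c(2) by (simp add: is_unit_iff_degree[OF \<open>p \<noteq> 0\<close>])
    fix u v assume uv: "p = u * v"
    then have nz: "u \<noteq> 0" "v \<noteq> 0" using \<open>p \<noteq> 0\<close> by auto
    then have sum: "degree p = degree u + degree v" using uv degree_mult_eq by blast
    have "u dvd a" using pa uv dvd_mult_left by blast
    then have "degree u = 0 \<or> degree c \<le> degree u" using c(3) by auto
    then have "degree u = 0 \<or> degree v = 0" using sum deg by linarith
    then show "u dvd 1 \<or> v dvd 1" using nz is_unit_iff_degree by blast
  qed
  then show thesis using that lc pa by blast
qed

text \<open>Induction on the degree, splitting off one monic irreducible factor. It either raises
  the exponent of a factor already present or is appended as a new one, so the factors stay
  distinct. The constant 1 has \<open>r = 0\<close>.\<close>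

lemma monic_factorization:
  fixes a :: "'k::field poly"
  assumes "lead_coeff a = 1"
  shows "\<exists>(r::nat) p n. inj_on p {1..r} \<and>
      (\<forall>j\<in>{1..r}. lead_coeff (p j) = 1 \<and> irreducible (p j) \<and> n j \<ge> (1::nat)) \<and>
      a = (\<Prod>j=1..r. p j ^ n j)"
  using assms
proof (induction "degree a" arbitrary: a rule: less_induct)
  case less
  show ?case
  proof (cases "degree a = 0")
    case True
    then have "a = 1" using less.prems by (intro monic_degree_0_eq_1)
    then show ?thesis by (intro exI[of _ 0]) auto
  next
    case False
    then obtain q where q: "lead_coeff q = 1" "irreducible q" "q dvd a"
      using monic_irreducible_divisor[of a] by auto
    then obtain b where b: "a = q * b" by (auto elim: dvdE)
    have nz: "q \<noteq> 0" "b \<noteq> 0" using b less.prems by auto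
    have lb: "lead_coeff b = 1" using less.prems q(1) unfolding b by (simp add: lead_coeff_mult)
    have "degree q > 0" using q(2) nz by (metis is_unit_iff_degree irreducible_not_unit gr0I)
    then have "degree b < degree a" using nz by (simp add: b degree_mult_eq)
    then obtain r :: nat and p n where IH: "inj_on p {1..r}"
        "\<And>j. j \<in> {1..r} \<Longrightarrow> lead_coeff (p j) = 1 \<and> irreducible (p j) \<and> n j \<ge> (1::nat)"
        "b = (\<Prod>j=1..r. p j ^ n j)"
      using less.hyps[OF _ lb] by metis
    show ?thesis
    proof (cases "q \<in> p ` {1..r}")
      case True
      then obtain k where k: "k \<in> {1..r}" "q = p k" by blast
      define m where "m = n(k := Suc (n k))"
      have "(\<Prod>j\<in>{1..r} - {k}. p j ^ m j) = (\<Prod>j\<in>{1..r} - {k}. p j ^ n j)"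
        by (rule prod.cong) (auto simp: m_def)
      then have "a = (\<Prod>j=1..r. p j ^ m j)"
        using prod.remove[OF _ k(1), of "\<lambda>j. p j ^ m j"] prod.remove[OF _ k(1), of "\<lambda>j. p j ^ n j"]
        by (simp add: b IH(3) k(2) m_def mult.assoc)
      moreover have "\<forall>j\<in>{1..r}. lead_coeff (p j) = 1 \<and> irreducible (p j) \<and> m j \<ge> 1"
        using IH(2) by (auto simp: m_def)
      ultimately show ?thesis using IH(1) by blast
    next
      case False
      define p' where "p' = p(Suc r := q)"
      define m where "m = n(Suc r := 1)"
      have I: "{1..Suc r} = insert (Suc r) {1..r}" by auto
      have "(\<Prod>j=1..r. p' j ^ m j) = (\<Prod>j=1..r. p j ^ n j)"
        by (rule prod.cong) (auto simp: m_def p'_def)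
      then have "a = (\<Prod>j=1..Suc r. p' j ^ m j)"
        by (simp add: b IH(3) p'_def m_def mult.commute)
      moreover have "\<forall>j\<in>{1..Suc r}. lead_coeff (p' j) = 1 \<and> irreducible (p' j) \<and> m j \<ge> 1"
        unfolding I using IH(2) q by (auto simp: m_def p'_def)
      moreover have "inj_on p' {1..Suc r}"
      proof -
        have eq: "p' j = p j" if "j \<in> {1..r}" for j using that by (simp add: p'_def)
        then have "p' ` {1..r} = p ` {1..r}" by (intro image_cong refl)
        moreover have "inj_on p' {1..r}" using IH(1) inj_on_cong[of "{1..r}" p' p] eq by blast
        moreover have "p' (Suc r) = q" by (simp add: p'_def)
        ultimately show ?thesis unfolding I using False by simp
      qed
      ultimately show ?thesis by blast
    qed
  qed
qed

section \<open>The \<open>k[x]\<close>-module defined by an endomorphism\<close>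

locale vector_space_endo = vector_space scale
  for scale :: "'k::field \<Rightarrow> 'v::ab_group_add \<Rightarrow> 'v" +
  fixes f :: "'v \<Rightarrow> 'v"
  assumes linear_f: "Vector_Spaces.linear scale scale f"
begin

sublocale f: Vector_Spaces.linear scale scale f
  by (rule linear_f)

abbreviation "act \<equiv> poly_end scale f"

text \<open>For adding polynomials: the summation in \<open>poly_end\<close> ends at the degree, and
  two polynomials need a common bound.\<close>

lemma act_eq_sum: "degree q \<le> n \<Longrightarrow> act q v = (\<Sum>i\<le>n. scale (coeff q i) ((f ^^ i) v))"
  unfolding poly_end_def by (rule sum.mono_neutral_left) (auto simp: coeff_eq_0)

lemma act_0: "act 0 v = 0"
  by (simp add: poly_end_def)

lemma act_pCons: "act (pCons a q) v = scale a v + f (act q v)"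
proof -
  have "act (pCons a q) v = (\<Sum>i\<le>Suc (degree q). scale (coeff (pCons a q) i) ((f ^^ i) v))"
    by (rule act_eq_sum) (rule degree_pCons_le)
  also have "\<dots> = scale a v + (\<Sum>i\<le>degree q. f (scale (coeff q i) ((f ^^ i) v)))"
    by (simp add: sum.atMost_Suc_shift f.scale del: sum.atMost_Suc)
  also have "\<dots> = scale a v + f (act q v)"
    by (simp add: poly_end_def f.sum)
  finally show ?thesis .
qed

lemma act_add_left: "act (p + q) v = act p v + act q v"
proof -
  let ?n = "max (degree p) (degree q)"
  have "degree (p + q) \<le> ?n" by (rule degree_add_le) auto
  then show ?thesis
    using act_eq_sum[of p ?n] act_eq_sum[of q ?n] act_eq_sum[of "p + q" ?n]
    by (simp add: scale_left_distrib sum.distrib)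
qed

lemma act_add_right: "act q (v + w) = act q v + act q w"
  by (induction q) (simp_all add: act_0 act_pCons f.add scale_right_distrib)

lemma act_smult: "act (Polynomial.smult c q) v = scale c (act q v)"
  by (induction q) (simp_all add: act_0 act_pCons f.scale scale_right_distrib)

lemma act_mult: "act (p * q) v = act p (act q v)"
  by (induction p) (simp_all add: act_0 act_pCons act_add_left act_smult)

lemma act_const: "act [:c:] v = scale c v"
  by (simp add: act_0 act_pCons f.zero)

lemma act_X: "act [:0, 1:] v = f v"
  by (simp add: act_0 act_pCons f.zero)

sublocale act: Modules.module act
proof
  show "act 1 v = v" for v using act_const[of 1 v] by (simp add: one_pCons)
qed (simp_all add: act_add_left act_add_right act_mult)

lemma ker_pow_eq: "ker_pow scale f p i = power_kernel act p i"
proof -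
  have "(act p ^^ i) v = act (p ^ i) v" for v
    by (induction i) simp_all
  then show ?thesis by (simp add: ker_pow_def power_kernel_def)
qed

lemma nu_denominator_eq: "nu_denominator scale f p i = decomposable_part act p i"
  unfolding nu_denominator_def decomposable_part_def ker_pow_eq ..

end

section \<open>Annihilator polynomial and residue field\<close>

lemma PIdl_class_ring: "PIdl\<^bsub>class_ring\<^esub> (a :: 'a::comm_ring_1) = {q. a dvd q}"
  by (auto simp: cgenideal_def dvd_def mult.commute)

text \<open>Justifies the definite description: the annihilating polynomials form a nonzero ideal,
  and two monic generators divide each other.\<close>

lemma (in vector_space_endo) annihilator_poly:
  assumes "admits_annihilating_poly scale f"
  shows "lead_coeff (annihilator_poly scale f) = 1"
    and "(\<forall>v. act q v = 0) \<longleftrightarrow> annihilator_poly scale f dvd q"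
proof -
  define J where "J = {q. act q = (\<lambda>_. 0)}"
  obtain a where a: "a \<in> J" "a \<noteq> 0" using assms by (auto simp: admits_annihilating_poly_def J_def)
  obtain d where d: "lead_coeff d = 1" "J = {q. d dvd q}"
    by (rule poly_ideal_monic_generator[OF a]) (auto simp: J_def fun_eq_iff act_add_left act_mult)
  have unique: "a = d" if "lead_coeff a = 1" "{q. a dvd q} = J" for a
  proof (rule monic_dvd_antisym)
    have "d \<in> {q. d dvd q}" "a \<in> {q. a dvd q}" by simp_all
    then have "d \<in> J" "a \<in> J" by (simp_all only: that(2) d(2)[symmetric])
    then have "d \<in> {q. a dvd q}" "a \<in> {q. d dvd q}" by (simp_all only: that(2) d(2)[symmetric])
    then show "a dvd d" "d dvd a" by simp_all
  qed (fact that(1) d(1))+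
  have "annihilator_poly scale f = d"
    unfolding annihilator_poly_def PIdl_class_ring J_def[symmetric]
    using d unique by (intro the_equality) auto
  then show "lead_coeff (annihilator_poly scale f) = 1"
    and "(\<forall>v. act q v = 0) \<longleftrightarrow> annihilator_poly scale f dvd q"
    using d(1) eqset_imp_iff[OF d(2), of q] by (simp_all add: J_def fun_eq_iff)
qed

text \<open>An ideal that contains \<open>p\<close> and some \<open>q\<close> not divisible by
  \<open>p\<close> contains 1 by a Bezout identity, so the ideal of \<open>p\<close> is
  maximal.\<close>

lemma field_poly_residue_field:
  assumes "irreducible p"
  shows "field (poly_residue_field p)"
proof -
  have "maximalideal (PIdl\<^bsub>class_ring\<^esub> p) class_ring"
  proof (rule maximalidealI)
    show "ideal (PIdl\<^bsub>class_ring\<^esub> p) class_ring"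
      by (rule cring.cgenideal_ideal[OF class_cring.is_cring]) simp
    have "\<not> p dvd 1" using assms by (rule irreducible_not_unit)
    then show "carrier class_ring \<noteq> PIdl\<^bsub>class_ring\<^esub> p"
      by (auto simp: PIdl_class_ring)
    fix J assume J: "ideal J class_ring" "PIdl\<^bsub>class_ring\<^esub> p \<subseteq> J"
    then interpret J: ideal J "class_ring :: 'a poly ring" by simp
    have "J = UNIV" if q: "q \<in> J" "\<not> p dvd q" for q
    proof -
      obtain s t where st: "s * p + t * q = 1"
        using irreducible_imp_comaximal[OF assms q(2)] by (auto simp: comaximal_def)
      have "p \<in> J" using J(2) by (auto simp: PIdl_class_ring)
      then have "s * p \<in> J" "t * q \<in> J" using J.I_l_closed q(1) by auto
      then have "s * p + t * q \<in> J" using J.a_closed by auto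
      then have "1 \<in> J" using st by simp
      then show ?thesis using J.one_imp_carrier by auto
    qed
    then show "J = PIdl\<^bsub>class_ring\<^esub> p \<or> J = carrier class_ring"
      using J(2) by (auto simp: PIdl_class_ring)
  qed
  then show ?thesis
    unfolding poly_residue_field_def
    using maximalideal.quotient_is_field class_cring.is_cring by blast
qed

subsection \<open>The quotients defining \<open>\<nu>\<^sub>i\<close>\<close>

text \<open>The vector space axioms for \<open>V\<close> hold because \<open>cs\<close> carries the
  operations of the submodule \<open>N\<close> to those of \<open>V\<close>. For a concrete quotient
  only formulas on representatives remain to be checked.\<close>

lemma residue_presentationI:
  fixes K :: "('a, 'b) ring_scheme" and V :: "('a, 'c, 'd) module_scheme"
    and act :: "'r::comm_ring_1 \<Rightarrow> 'v::ab_group_add \<Rightarrow> 'v"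
  assumes K: "field K" and act: "Modules.module act" and N: "Modules.module.subspace act N"
    and carrier_K: "carrier K = range cl" and carrier_V: "carrier V = cs ` N"
    and cl: "\<And>q r. cl q \<oplus>\<^bsub>K\<^esub> cl r = cl (q + r)" "\<And>q r. cl q \<otimes>\<^bsub>K\<^esub> cl r = cl (q * r)" "\<one>\<^bsub>K\<^esub> = cl 1"
    and cl_eq_zero: "\<And>q. cl q = \<zero>\<^bsub>K\<^esub> \<longleftrightarrow> p dvd q"
    and cs_eq: "\<And>v w. v \<in> N \<Longrightarrow> w \<in> N \<Longrightarrow> cs v = cs w \<longleftrightarrow> v - w \<in> D"
    and cs_add: "\<And>v w. v \<in> N \<Longrightarrow> w \<in> N \<Longrightarrow> cs v \<oplus>\<^bsub>V\<^esub> cs w = cs (v + w)"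
    and cs_zero: "cs 0 = \<zero>\<^bsub>V\<^esub>"
    and cs_act: "\<And>q v. v \<in> N \<Longrightarrow> cl q \<odot>\<^bsub>V\<^esub> cs v = cs (act q v)"
  shows "residue_presentation K V act N D p cl cs"
proof -
  interpret a: Modules.module act by fact
  note closed = a.subspace_add[OF N] a.subspace_scale[OF N] a.subspace_0[OF N] a.subspace_neg[OF N]
  have zero: "\<zero>\<^bsub>V\<^esub> = cs 0" using cs_zero by simp
  interpret vectorspace K V
  proof (rule vs_criteria)
    show "\<zero>\<^bsub>V\<^esub> \<in> carrier V" using closed by (simp add: carrier_V zero)
    show "\<forall>v\<in>carrier V. \<exists>neg_v\<in>carrier V. v \<oplus>\<^bsub>V\<^esub> neg_v = \<zero>\<^bsub>V\<^esub>"
    proof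
      fix x assume "x \<in> carrier V"
      then obtain v where v: "v \<in> N" "x = cs v" by (auto simp: carrier_V)
      have "x \<oplus>\<^bsub>V\<^esub> cs (- v) = \<zero>\<^bsub>V\<^esub>" using v cs_add[of v "- v"] closed by (simp add: zero)
      then show "\<exists>neg_v\<in>carrier V. x \<oplus>\<^bsub>V\<^esub> neg_v = \<zero>\<^bsub>V\<^esub>" using v closed by (auto simp: carrier_V)
    qed
  qed (use K closed in \<open>auto simp: carrier_K carrier_V zero cl cs_add cs_act
        a.scale_left_distrib a.scale_right_distrib add_ac\<close>)
  show ?thesis
    by unfold_locales (fact N carrier_K carrier_V cl_eq_zero cs_eq cs_add cs_zero cs_act)+
qed

context Modules.module begin

lemma power_kernel_Suc: "v \<in> power_kernel scale p (i - 1) \<Longrightarrow> v \<in> power_kernel scale p i"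
  by (cases i) (auto simp: power_kernel_iff scale_scale[symmetric] simp del: scale_scale)

lemma subspace_decomposable_part: "subspace (decomposable_part scale p i)"
proof -
  let ?K = "power_kernel scale p"
  have mem: "u + scale p w \<in> decomposable_part scale p i" if "u \<in> ?K (i - 1)" "w \<in> ?K (i + 1)" for u w
    using that unfolding decomposable_part_def by blast
  note closed = subspace_0[OF subspace_power_kernel] subspace_add[OF subspace_power_kernel]
    subspace_scale[OF subspace_power_kernel]
  show ?thesis
  proof (rule subspaceI)
    show "0 \<in> decomposable_part scale p i" using mem[of 0 0] closed by simp
  next
    fix x y assume x: "x \<in> decomposable_part scale p i" and y: "y \<in> decomposable_part scale p i"
    obtain u w where 1: "x = u + scale p w" "u \<in> ?K (i - 1)" "w \<in> ?K (i + 1)"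
      using x unfolding decomposable_part_def by blast
    obtain u' w' where 2: "y = u' + scale p w'" "u' \<in> ?K (i - 1)" "w' \<in> ?K (i + 1)"
      using y unfolding decomposable_part_def by blast
    have "x + y = (u + u') + scale p (w + w')" by (simp add: 1 2 algebra_simps)
    then show "x + y \<in> decomposable_part scale p i"
      using mem[OF closed(2)[OF 1(2) 2(2)] closed(2)[OF 1(3) 2(3)]] by simp
  next
    fix c x assume x: "x \<in> decomposable_part scale p i"
    obtain u w where 1: "x = u + scale p w" "u \<in> ?K (i - 1)" "w \<in> ?K (i + 1)"
      using x unfolding decomposable_part_def by blast
    have "scale c x = scale c u + scale p (scale c w)" by (simp add: 1 scale_right_distrib mult.commute)
    then show "scale c x \<in> decomposable_part scale p i"
      using mem[OF closed(3)[OF 1(2), of c] closed(3)[OF 1(3), of c]] by simp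
  qed
qed

lemma decomposable_part_subset: "decomposable_part scale p i \<subseteq> power_kernel scale p i"
proof
  fix x assume "x \<in> decomposable_part scale p i"
  then obtain u w where 1: "x = u + scale p w" "u \<in> power_kernel scale p (i - 1)" "w \<in> power_kernel scale p (i + 1)"
    unfolding decomposable_part_def by blast
  have "scale p w \<in> power_kernel scale p i"
    using 1(3) by (simp add: power_kernel_iff mult.commute)
  then show "x \<in> power_kernel scale p i"
    unfolding 1(1) using power_kernel_Suc[OF 1(2)] by (intro subspace_add[OF subspace_power_kernel])
qed

text \<open>This is why \<open>p\<close> acts as zero on the quotient, so that the residue field
  acts on it.\<close>

lemma scale_power_kernel_decomposable:
  assumes "v \<in> power_kernel scale p i"
  shows "scale p v \<in> decomposable_part scale p i"
proof -
  have "v \<in> power_kernel scale p (i + 1)" using assms power_kernel_Suc[of v p "i + 1"] by simp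
  moreover have "0 \<in> power_kernel scale p (i - 1)" using subspace_0[OF subspace_power_kernel] .
  ultimately have "0 + scale p v \<in> decomposable_part scale p i"
    unfolding decomposable_part_def by blast
  then show ?thesis by simp
qed

end

lemma (in vector_space_endo) nu_quotient_presentation:
  fixes p :: "'k poly" and i :: nat
  defines "D \<equiv> decomposable_part act p i"
  assumes p: "irreducible p"
  shows "residue_presentation (poly_residue_field p) (nu_quotient scale f p i) act
    (power_kernel act p i) D p (\<lambda>q. PIdl\<^bsub>class_ring\<^esub> p +>\<^bsub>class_ring\<^esub> q) (\<lambda>v. (\<lambda>d. d + v) ` D)"
proof -
  let ?K = "poly_residue_field p" and ?V = "nu_quotient scale f p i" and ?I = "PIdl\<^bsub>class_ring\<^esub> p"
  define N where "N = power_kernel act p i"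
  define G :: "'v ring" where "G = \<lparr>carrier = N, mult = undefined, one = undefined, zero = 0, add = (+)\<rparr>"
  define cl where "cl q = ?I +>\<^bsub>class_ring\<^esub> q" for q
  define cs where "cs v = (\<lambda>d. d + v) ` D" for v
  have cl_alt: "cl q = {r. p dvd r - q}" for q
  proof -
    have "r = (r - q) + q" for r by simp
    then show ?thesis unfolding cl_def PIdl_class_ring a_r_coset_def' by auto
  qed
  have coset: "D +>\<^bsub>G\<^esub> v = cs v" for v
    unfolding cs_def a_r_coset_def' by (auto simp: G_def)
  have Q: "?V = \<lparr>carrier = a_rcosets\<^bsub>G\<^esub> D, mult = undefined, one = undefined, zero = D, add = set_add G,
      smult = (\<lambda>C X. \<Union>q\<in>C. \<Union>v\<in>X. D +>\<^bsub>G\<^esub> act q v)\<rparr>"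
    by (simp add: nu_quotient_def ker_pow_eq nu_denominator_eq Let_def G_def N_def D_def)
  have "carrier G = N" by (simp add: G_def)
  then have V: "carrier ?V = cs ` N" "zero ?V = D" "add ?V = set_add G"
      "smult ?V = (\<lambda>C X. \<Union>q\<in>C. \<Union>v\<in>X. cs (act q v))"
    unfolding Q A_RCOSETS_def' coset by auto
  have N: "act.subspace N" unfolding N_def by (rule act.subspace_power_kernel)
  have D: "act.subspace D" unfolding D_def by (rule act.subspace_decomposable_part)
  have DN: "D \<subseteq> N" unfolding D_def N_def by (rule act.decomposable_part_subset)
  have cs_eq: "cs v = cs w \<longleftrightarrow> v - w \<in> D" for v w
  proof
    assume "cs v = cs w"
    moreover have "v \<in> cs v" unfolding cs_def using act.subspace_0[OF D] by force
    ultimately obtain d where "d \<in> D" "v = d + w" unfolding cs_def by blast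
    then show "v - w \<in> D" by simp
  next
    have sub: "cs v \<subseteq> cs w" if "v - w \<in> D" for v w
    proof
      fix x assume "x \<in> cs v"
      then obtain d where d: "d \<in> D" "x = d + v" unfolding cs_def by blast
      then have "x = (d + (v - w)) + w" "d + (v - w) \<in> D"
        using act.subspace_add[OF D] that by auto
      then show "x \<in> cs w" unfolding cs_def by blast
    qed
    assume "v - w \<in> D"
    moreover have "w - v \<in> D" using act.subspace_neg[OF D \<open>v - w \<in> D\<close>] by simp
    ultimately show "cs v = cs w" using sub by blast
  qed
  interpret I: ideal ?I "class_ring :: 'k poly ring"
    by (rule cring.cgenideal_ideal[OF class_cring.is_cring]) simp
  have "residue_presentation ?K ?V act N D p cl cs"
  proof (rule residue_presentationI)
    show "field ?K" using p by (rule field_poly_residue_field)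
    show "carrier ?K = range cl"
      by (auto simp: poly_residue_field_def FactRing_def A_RCOSETS_def' cl_def)
    show "cl q \<oplus>\<^bsub>?K\<^esub> cl r = cl (q + r)" for q r
      using I.a_rcos_sum[of q r] by (simp add: poly_residue_field_def FactRing_def cl_def)
    show "cl q \<otimes>\<^bsub>?K\<^esub> cl r = cl (q * r)" for q r
      using I.rcoset_mult_add[of q r] by (simp add: poly_residue_field_def FactRing_def cl_def)
    show "\<one>\<^bsub>?K\<^esub> = cl 1"
      by (simp add: poly_residue_field_def FactRing_def cl_def)
    show "cl q = \<zero>\<^bsub>?K\<^esub> \<longleftrightarrow> p dvd q" for q
    proof -
      have "\<zero>\<^bsub>?K\<^esub> = {r. p dvd r}"
        by (simp add: poly_residue_field_def FactRing_def PIdl_class_ring)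
      \<comment> \<open>From left to right, take \<open>r = 0\<close>.\<close>
      moreover have "(\<forall>r. p dvd r - q \<longleftrightarrow> p dvd r) \<longleftrightarrow> p dvd q"
        by (metis diff_0 dvd_0_right dvd_diff_left_iff dvd_minus_iff)
      ultimately show ?thesis unfolding cl_alt by auto
    qed
    show "carrier ?V = cs ` N" by (fact V)
    show "cs v \<oplus>\<^bsub>?V\<^esub> cs w = cs (v + w)" for v w
    proof -
      have "cs v \<oplus>\<^bsub>?V\<^esub> cs w = {(d + v) + (e + w) | d e. d \<in> D \<and> e \<in> D}"
        unfolding V set_add_def' by (auto simp: cs_def G_def)
      also have "\<dots> = cs (v + w)"
      proof (intro equalityI subsetI)
        fix x assume "x \<in> {(d + v) + (e + w) | d e. d \<in> D \<and> e \<in> D}"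
        then obtain d e where x: "x = (d + v) + (e + w)" "d \<in> D" "e \<in> D" by blast
        then have "x = (d + e) + (v + w)" by (simp add: add_ac)
        then show "x \<in> cs (v + w)" unfolding cs_def using act.subspace_add[OF D x(2,3)] by blast
      next
        fix x assume "x \<in> cs (v + w)"
        then obtain d where d: "d \<in> D" "x = d + (v + w)" unfolding cs_def by blast
        then have "x = (d + v) + (0 + w)" by (simp add: add_ac)
        then show "x \<in> {(d + v) + (e + w) | d e. d \<in> D \<and> e \<in> D}"
          using d(1) act.subspace_0[OF D] by blast
      qed
      finally show ?thesis .
    qed
    show "cs 0 = \<zero>\<^bsub>?V\<^esub>" by (simp add: V cs_def)
    show "cl q \<odot>\<^bsub>?V\<^esub> cs v = cs (act q v)" if v: "v \<in> N" for q v
    proof -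
      \<comment> \<open>All cosets in the union that defines the scalar multiplication are equal:
        another polynomial of the class adds \<open>p\<close> applied to a vector of
        \<open>N\<close>, another vector of the coset adds \<open>q\<close> applied to a vector of
        \<open>D\<close>, and both lie in \<open>D\<close>.\<close>
      have "cs (act r w) = cs (act q v)" if r: "r \<in> cl q" and w: "w \<in> cs v" for r w
      proof -
        obtain c where c: "r - q = p * c" using r by (auto simp: cl_alt elim: dvdE)
        obtain d where d: "d \<in> D" "w = d + v" using w by (auto simp: cs_def)
        have "act r w - act q v = act (r - q) w + act q d"
          by (simp add: d act.scale_left_diff_distrib act.scale_right_distrib)
        also have "act (r - q) w = act p (act c w)" by (simp add: c)
        finally have eq: "act r w - act q v = act p (act c w) + act q d" .
        have "w \<in> N" using act.subspace_add[OF N] d v DN by blast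
        then have "act p (act c w) \<in> D"
          using act.scale_power_kernel_decomposable act.subspace_scale[OF N] unfolding N_def D_def by blast
        moreover have "act q d \<in> D" using act.subspace_scale[OF D d(1)] .
        ultimately show ?thesis using act.subspace_add[OF D] eq cs_eq by simp
      qed
      moreover have "q \<in> cl q" by (simp add: cl_alt)
      moreover have "v \<in> cs v" unfolding cs_def using act.subspace_0[OF D] by force
      ultimately show ?thesis unfolding V by blast
    qed
  qed (simp_all only: N cs_eq act.module_axioms)
  then show ?thesis unfolding cl_def cs_def N_def .
qed

section \<open>Sets of representatives: existence, cardinality and transport along
  isomorphisms\<close>

context vector_space_endo begin

lemma ex_rep_basis:
  assumes "irreducible p"
  shows "\<exists>R. rep_basis act (power_kernel act p i) (decomposable_part act p i) p R"
proof -
  interpret Q: residue_presentation "poly_residue_field p" "nu_quotient scale f p i" act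
    "power_kernel act p i" "decomposable_part act p i" p
    "\<lambda>q. PIdl\<^bsub>class_ring\<^esub> p +>\<^bsub>class_ring\<^esub> q" "\<lambda>v. (\<lambda>d. d + v) ` decomposable_part act p i"
    using assms by (rule nu_quotient_presentation)
  show ?thesis using Q.basis_exists Q.basis_imp_rep_basis by metis
qed

text \<open>Distinct representatives have distinct cosets, so \<open>R\<close> has the cardinality
  of a basis of the quotient, and \<open>nu\<close> can be computed with vectors of V.\<close>

lemma rep_basis_nu:
  assumes "irreducible p"
    and R: "rep_basis act (power_kernel act p i) (decomposable_part act p i) p R"
  shows "(card_of R, nu scale f p i) \<in> ordIso"
proof -
  let ?cs = "\<lambda>v. (\<lambda>d. d + v) ` decomposable_part act p i"
  interpret Q: residue_presentation "poly_residue_field p" "nu_quotient scale f p i" act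
    "power_kernel act p i" "decomposable_part act p i" p
    "\<lambda>q. PIdl\<^bsub>class_ring\<^esub> p +>\<^bsub>class_ring\<^esub> q" ?cs
    using assms(1) by (rule nu_quotient_presentation)
  have inj: "inj_on ?cs R" using R by (rule Q.rep_basis_imp_inj_on)
  have "Q.basis (?cs ` R)" using Q.rep_basis_iff_basis[OF rep_basis_subset[OF R] inj] R by blast
  then have "(card_of (?cs ` R), nu scale f p i) \<in> ordIso"
    unfolding nu_def by (rule Q.vs_dim_ordIso)
  moreover have "(card_of R, card_of (?cs ` R)) \<in> ordIso"
    using inj by (intro card_of_ordIsoI[of ?cs]) (simp add: bij_betw_def)
  ultimately show ?thesis using ordIso_transitive by blast
qed

end

text \<open>A module isomorphism carries kernels and denominators to each other. On representatives
  this gives the invariance of \<open>nu\<close> without any map between the quotients.\<close>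

lemma rep_basis_image:
  assumes "bij \<tau>" "\<And>v w. \<tau> (v + w) = \<tau> v + \<tau> w" "\<And>q v. \<tau> (act q v) = act' q (\<tau> v)"
    and R: "rep_basis act (power_kernel act p i) (decomposable_part act p i) p R"
  shows "rep_basis act' (power_kernel act' p i) (decomposable_part act' p i) p (\<tau> ` R)"
proof -
  have inj: "inj \<tau>" and surj: "surj \<tau>" using assms(1) by (auto simp: bij_def)
  interpret additive \<tau> by standard (rule assms(2))
  have zero_iff: "\<tau> v = 0 \<longleftrightarrow> v = 0" for v using injD[OF inj, of v 0] zero by auto
  have K: "power_kernel act' p j = \<tau> ` power_kernel act p j" for j
  proof (intro equalityI subsetI)
    fix w assume w: "w \<in> power_kernel act' p j"
    obtain v where v: "w = \<tau> v" using surj by (metis surjD)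
    then have "v \<in> power_kernel act p j"
      using w zero_iff by (simp add: power_kernel_def assms(3)[symmetric])
    then show "w \<in> \<tau> ` power_kernel act p j" using v by blast
  qed (auto simp: power_kernel_def assms(3)[symmetric] zero)
  have D: "decomposable_part act' p i = \<tau> ` decomposable_part act p i"
  proof (intro equalityI subsetI)
    fix x assume "x \<in> decomposable_part act' p i"
    then obtain u w where "x = \<tau> u + act' p (\<tau> w)" "u \<in> power_kernel act p (i - 1)"
        "w \<in> power_kernel act p (i + 1)"
      unfolding decomposable_part_def K by blast
    moreover from this have "x = \<tau> (u + act p w)" by (simp add: assms)
    ultimately show "x \<in> \<tau> ` decomposable_part act p i" unfolding decomposable_part_def by blast
  next
    fix x assume "x \<in> \<tau> ` decomposable_part act p i"
    then obtain u w where "x = \<tau> (u + act p w)" and uw: "u \<in> power_kernel act p (i - 1)"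
        "w \<in> power_kernel act p (i + 1)"
      unfolding decomposable_part_def by blast
    then have "x = \<tau> u + act' p (\<tau> w)" by (simp add: assms)
    then show "x \<in> decomposable_part act' p i" unfolding decomposable_part_def K using uw by blast
  qed
  have sum: "(\<Sum>b\<in>\<tau> ` S. act' (q b) b) = \<tau> (\<Sum>b\<in>S. act (q (\<tau> b)) b)" for S q
    by (simp add: sum assms(3) sum.reindex[OF inj_on_subset[OF inj]])
  have mem: "\<tau> v \<in> \<tau> ` A \<longleftrightarrow> v \<in> A" for v A using inj by (simp add: inj_image_mem_iff)
  show ?thesis
    unfolding rep_basis_def K D
  proof (intro conjI ballI allI impI)
    show "\<tau> ` R \<subseteq> \<tau> ` power_kernel act p i" using rep_basis_subset[OF R] by blast
  next
    fix w assume "w \<in> \<tau> ` power_kernel act p i"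
    then obtain v where v: "v \<in> power_kernel act p i" "w = \<tau> v" by blast
    then obtain S q where S: "finite S" "S \<subseteq> R" "v - (\<Sum>b\<in>S. act (q b) b) \<in> decomposable_part act p i"
      using R unfolding rep_basis_def by meson
    \<comment> \<open>Coefficients are indexed by the vectors themselves, hence the inverse of
      \<open>\<tau>\<close>.\<close>
    let ?q = "\<lambda>b. q (inv_into UNIV \<tau> b)"
    have "w - (\<Sum>b\<in>\<tau> ` S. act' (?q b) b) = \<tau> (v - (\<Sum>b\<in>S. act (q b) b))"
      by (simp add: sum v(2) diff inv_f_f[OF inj])
    then show "\<exists>S q. finite S \<and> S \<subseteq> \<tau> ` R \<and> w - (\<Sum>b\<in>S. act' (q b) b) \<in> \<tau> ` decomposable_part act p i"
      using S by (intro exI[of _ "\<tau> ` S"] exI[of _ ?q]) auto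
  next
    fix T q b assume T: "finite T" "T \<subseteq> \<tau> ` R" "(\<Sum>b\<in>T. act' (q b) b) \<in> \<tau> ` decomposable_part act p i"
      and b: "b \<in> T"
    obtain S where S: "S \<subseteq> R" "T = \<tau> ` S" using T(2) by (meson subset_imageE)
    then have "finite S" using T(1) finite_imageD inj_on_subset[OF inj] by blast
    moreover have "(\<Sum>b\<in>S. act (q (\<tau> b)) b) \<in> decomposable_part act p i"
      using T(3) by (simp add: S(2) sum mem)
    moreover obtain c where c: "c \<in> S" "b = \<tau> c" using b S(2) by blast
    ultimately show "p dvd q b" using rep_basisD[OF R _ S(1), of "\<lambda>b. q (\<tau> b)" c] by simp
  qed
qed

subsection \<open>Conjugacy\<close>

theorem theorem3p9:
  fixes scale :: "'k::field \<Rightarrow> 'v::ab_group_add \<Rightarrow> 'v"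
    and f g :: "'v \<Rightarrow> 'v"
  assumes "vector_space scale"
    and "Vector_Spaces.linear scale scale f"
    and "Vector_Spaces.linear scale scale g"
    and "admits_annihilating_poly scale f"
    and "admits_annihilating_poly scale g"
  shows "(\<exists>\<tau>. Vector_Spaces.linear scale scale \<tau> \<and> bij \<tau> \<and> g = \<tau> \<circ> f \<circ> inv_into UNIV \<tau>) \<longleftrightarrow>
    (\<exists>(r::nat) (p :: nat \<Rightarrow> 'k poly) (n :: nat \<Rightarrow> nat).
       inj_on p {1..r} \<and>
       (\<forall>j\<in>{1..r}. lead_coeff (p j) = 1 \<and> irreducible (p j) \<and> n j \<ge> 1) \<and>
       annihilator_poly scale g = annihilator_poly scale f \<and>
       annihilator_poly scale f = (\<Prod>j=1..r. p j ^ n j) \<and>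
       (\<forall>j\<in>{1..r}. \<forall>i\<in>{1..n j}. (nu scale f (p j) i, nu scale g (p j) i) \<in> ordIso))"
    (is "?conj \<longleftrightarrow> ?inv")
proof -
  interpret F: vector_space_endo scale f
    using assms by (intro vector_space_endo.intro vector_space_endo_axioms.intro)
  interpret G: vector_space_endo scale g
    using assms by (intro vector_space_endo.intro vector_space_endo_axioms.intro)
  let ?act = "poly_end scale f" and ?act' = "poly_end scale g"
  show ?thesis
  proof
    assume ?conj
    then obtain \<tau> where \<tau>: "Vector_Spaces.linear scale scale \<tau>" "bij \<tau>"
        and g: "g = \<tau> \<circ> f \<circ> inv_into UNIV \<tau>" by blast
    interpret t: Vector_Spaces.linear scale scale \<tau> by (fact \<tau>(1))
    have inj: "inj \<tau>" and surj: "surj \<tau>" using \<tau>(2) by (auto simp: bij_def)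
    \<comment> \<open>Commuting with the action of \<open>x\<close> entails commuting with every
      polynomial, so \<open>\<tau>\<close> is an isomorphism of \<open>k[x]\<close>-modules.\<close>
    have "\<tau> (f v) = g (\<tau> v)" for v by (simp add: g inv_f_f[OF inj])
    then have hom: "\<tau> (?act q v) = ?act' q (\<tau> v)" for q v
      by (induction q) (simp_all add: F.act_0 G.act_0 F.act_pCons G.act_pCons t.add t.scale t.zero)
    have "?act' q = (\<lambda>_. 0) \<longleftrightarrow> ?act q = (\<lambda>_. 0)" for q
    proof -
      have "(\<forall>w. ?act' q w = 0) \<longleftrightarrow> (\<forall>v. ?act' q (\<tau> v) = 0)" using surj by (metis surjD)
      also have "\<dots> \<longleftrightarrow> (\<forall>v. ?act q v = 0)"
        using injD[OF inj, of _ 0] by (auto simp: hom[symmetric] t.zero)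
      finally show ?thesis by (simp add: fun_eq_iff)
    qed
    then have ann: "annihilator_poly scale g = annihilator_poly scale f"
      by (simp add: annihilator_poly_def)
    obtain r :: nat and p n where p: "inj_on p {1..r}"
        "\<forall>j\<in>{1..r}. lead_coeff (p j) = 1 \<and> irreducible (p j) \<and> n j \<ge> (1::nat)"
        "annihilator_poly scale f = (\<Prod>j=1..r. p j ^ n j)"
      using monic_factorization[OF F.annihilator_poly(1)[OF assms(4)]] by blast
    have "(nu scale f (p j) i, nu scale g (p j) i) \<in> ordIso" if "j \<in> {1..r}" for i j
    proof -
      have irr: "irreducible (p j)" using p(2) that by blast
      obtain R where R: "rep_basis ?act (power_kernel ?act (p j) i) (decomposable_part ?act (p j) i) (p j) R"
        using F.ex_rep_basis[OF irr] by blast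
      have R': "rep_basis ?act' (power_kernel ?act' (p j) i) (decomposable_part ?act' (p j) i) (p j) (\<tau> ` R)"
        by (rule rep_basis_image[OF \<tau>(2) t.add hom R])
      have eq: "(card_of R, card_of (\<tau> ` R)) \<in> ordIso"
        using inj_on_subset[OF inj] by (intro card_of_ordIsoI[of \<tau>]) (simp add: bij_betw_def)
      show ?thesis
        by (rule ordIso_transitive[OF ordIso_symmetric[OF F.rep_basis_nu[OF irr R]]
              ordIso_transitive[OF eq G.rep_basis_nu[OF irr R']]])
    qed
    then show ?inv using p ann by blast
  next
    assume ?inv
    then obtain r :: nat and p n where inj: "inj_on p {1..r}"
        and p: "\<And>j. j \<in> {1..r} \<Longrightarrow> lead_coeff (p j) = 1 \<and> irreducible (p j) \<and> n j \<ge> (1::nat)"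
        and ann: "annihilator_poly scale g = annihilator_poly scale f"
        and prod: "annihilator_poly scale f = (\<Prod>j=1..r. p j ^ n j)"
        and nu: "\<And>j i. j \<in> {1..r} \<Longrightarrow> i \<in> {1..n j} \<Longrightarrow>
          (nu scale f (p j) i, nu scale g (p j) i) \<in> ordIso"
      by blast
    let ?J = "{1..r}"
    define rep where "rep act j i R \<longleftrightarrow>
        rep_basis act (power_kernel act (p j) i) (decomposable_part act (p j) i) (p j) R"
      for act :: "'k poly \<Rightarrow> 'v \<Rightarrow> 'v" and i j R
    have cancel: "a dvd b" if "j \<in> ?J" "p j * a dvd p j * b" for j a b
      using that p[OF that(1)] by (auto simp: dvd_times_left_cancel_iff)
    \<comment> \<open>Distinct monic irreducible polynomials do not divide each other.\<close>
    have com: "comaximal (p j) (p k)" if "j \<in> ?J" "k \<in> ?J" "j \<noteq> k" for j k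
      using that inj p[of j] p[of k]
      by (metis inj_onD irreducible_imp_comaximal monic_irreducible_dvd_imp_eq)
    have kill: "?act (\<Prod>j\<in>?J. p j ^ n j) v = 0" "?act' (\<Prod>j\<in>?J. p j ^ n j) v = 0" for v
      using F.annihilator_poly(2)[OF assms(4)] G.annihilator_poly(2)[OF assms(5)] prod ann
      by (metis dvd_refl)+
    have "\<forall>j i. \<exists>R. j \<in> ?J \<longrightarrow> rep ?act j i R"
      using F.ex_rep_basis p unfolding rep_def by blast
    then obtain R where R: "\<And>j i. j \<in> ?J \<Longrightarrow> rep ?act j i (R j i)" by metis
    have "\<forall>j i. \<exists>R. j \<in> ?J \<longrightarrow> rep ?act' j i R"
      using G.ex_rep_basis p unfolding rep_def by blast
    then obtain R' where R': "\<And>j i. j \<in> ?J \<Longrightarrow> rep ?act' j i (R' j i)" by metis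
    \<comment> \<open>The only use of condition (2): equal cardinals give bijections between the
      generators with the same factor and exponent.\<close>
    have "\<exists>\<phi>. bij_betw \<phi> (R j i) (R' j i)" if j: "j \<in> ?J" and i: "i \<in> {1..n j}" for j i
    proof -
      have irr: "irreducible (p j)" using p[OF j] by blast
      have "(card_of (R j i), card_of (R' j i)) \<in> ordIso"
        by (rule ordIso_transitive[OF F.rep_basis_nu[OF irr R[OF j, unfolded rep_def]]
              ordIso_transitive[OF nu[OF j i]
                ordIso_symmetric[OF G.rep_basis_nu[OF irr R'[OF j, unfolded rep_def]]]]])
      then show ?thesis by (simp add: card_of_ordIso)
    qed
    then obtain \<phi> where \<phi>: "\<And>j i. j \<in> ?J \<Longrightarrow> i \<in> {1..n j} \<Longrightarrow> bij_betw (\<phi> j i) (R j i) (R' j i)"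
      by metis
    \<comment> \<open>Since \<open>j\<close> and \<open>i\<close> are kept, \<open>\<Phi>\<close>
      preserves the orders \<open>p j ^ i\<close>, and the second decomposition can be reindexed by
      the generators of the first.\<close>
    define \<Phi> where "\<Phi> z = (fst z, fst (snd z), \<phi> (fst z) (fst (snd z)) (snd (snd z)))" for z
    let ?I = "SIGMA j:?J. SIGMA i:{1..n j}. R j i" and ?I' = "SIGMA j:?J. SIGMA i:{1..n j}. R' j i"
    have bij: "bij_betw \<Phi> ?I ?I'"
      unfolding bij_betw_def
    proof
      show "inj_on \<Phi> ?I"
      proof (rule inj_onI)
        fix y z assume y: "y \<in> ?I" and z: "z \<in> ?I" and eq: "\<Phi> y = \<Phi> z"
        obtain j i b c where yz: "y = (j, i, b)" "z = (j, i, c)" "\<phi> j i b = \<phi> j i c"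
          using eq by (cases y, cases z) (auto simp: \<Phi>_def)
        have "j \<in> ?J" "i \<in> {1..n j}" "b \<in> R j i" "c \<in> R j i" using y z yz by auto
        then have "b = c" using \<phi>[of j i] yz(3) by (auto simp: bij_betw_def inj_on_def)
        then show "y = z" using yz by simp
      qed
      show "\<Phi> ` ?I = ?I'"
      proof (intro equalityI subsetI)
        fix z assume "z \<in> \<Phi> ` ?I"
        then obtain j i b where z: "z = (j, i, \<phi> j i b)" "j \<in> ?J" "i \<in> {1..n j}" "b \<in> R j i"
          by (auto simp: \<Phi>_def)
        then have "\<phi> j i b \<in> R' j i" using \<phi>[of j i] bij_betwE by blast
        then show "z \<in> ?I'" using z by auto
      next
        fix z assume "z \<in> ?I'"
        then obtain j i c where z: "z = (j, i, c)" "j \<in> ?J" "i \<in> {1..n j}" "c \<in> R' j i" by auto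
        then obtain b where b: "b \<in> R j i" "c = \<phi> j i b" using \<phi>[of j i] by (auto simp: bij_betw_def)
        then have "z = \<Phi> (j, i, b)" "(j, i, b) \<in> ?I" using z by (auto simp: \<Phi>_def)
        then show "z \<in> \<Phi> ` ?I" by blast
      qed
    qed
    let ?ord = "\<lambda>z. p (fst z) ^ fst (snd z)"
    have dec: "cyclic_decomp ?act ?I (\<lambda>z. snd (snd z)) ?ord"
      by (rule F.act.primary_cyclic_decomp[OF _ cancel com kill(1) R[unfolded rep_def]]) simp_all
    have "cyclic_decomp ?act' ?I' (\<lambda>z. snd (snd z)) ?ord"
      by (rule G.act.primary_cyclic_decomp[OF _ cancel com kill(2) R'[unfolded rep_def]]) simp_all
    from cyclic_decomp_reindex[OF this bij]
    have dec': "cyclic_decomp ?act' ?I ((\<lambda>z. snd (snd z)) \<circ> \<Phi>) ?ord"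
      by (simp add: \<Phi>_def comp_def)
    obtain \<tau> where \<tau>: "bij \<tau>" "\<And>v w. \<tau> (v + w) = \<tau> v + \<tau> w" "\<And>q v. \<tau> (?act q v) = ?act' q (\<tau> v)"
      using cyclic_decomp_iso[OF F.act.module_axioms G.act.module_axioms dec dec'] by metis
    \<comment> \<open>Among the polynomials, the constants give linearity over k and
      \<open>x\<close> gives the intertwining of \<open>f\<close> and \<open>g\<close>.\<close>
    have "\<tau> (scale c v) = scale c (\<tau> v)" for c v
      using \<tau>(3)[of "[:c:]" v] by (simp add: F.act_const G.act_const)
    then have "Vector_Spaces.linear scale scale \<tau>"
      using \<tau>(2) assms(1) by (simp add: Vector_Spaces.linear_iff)
    moreover have "g = \<tau> \<circ> f \<circ> inv_into UNIV \<tau>"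
    proof
      fix w
      have "\<tau> (f v) = g (\<tau> v)" for v
        using \<tau>(3)[of "[:0, 1:]" v] by (simp add: F.act_X G.act_X)
      then show "g w = (\<tau> \<circ> f \<circ> inv_into UNIV \<tau>) w"
        using \<tau>(1) by (simp add: surj_f_inv_f bij_is_surj)
    qed
    ultimately show ?conj using \<tau>(1) by blast
  qed
qed

end
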